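(* Let $k\ge4$ and let $\mathbf{a}=(a_1,\dots,a_k)$ be integers with $a_1<a_2<\cdots<a_k$. Suppose either $k$ is odd or $\mathbf{a}$ is not symmetric. Then there is a constant $c>0$ depending only on $\mathbf{a}$ such that $\rho_{\mathbf{a}}(\alpha)<\alpha^{c\log(1/\alpha)}$ for all $0<\alpha<1/2$.
   Context: $\mathbf{a}$ is symmetric if $k$ is even and $a_1+a_k=a_2+a_{k-1}=a_3+a_{k-2}=\cdots$. For a finite abelian group $G$ and $f\colon G\to\mathbb{C}$, $\Lambda_{\mathbf{a}}(f)=\mathbb{E}_{n,d\in G}f(n+a_1d)f(n+a_2d)\cdots f(n+a_kd)$; $\partial_hf(n)=f(n)\overline{f(n-h)}$ and $\|f\|_{U^s}^{2^s}=\mathbb{E}_{n,h_1,\dots,h_s}\partial_{h_1}\cdots\partial_{h_s}f(n)$. For $0<\alpha<1$, $\rho_{\mathbf{a}}(\alpha)$ is the largest real number such that for every $\epsilon>0$ there exist $\eta>0$ and $N_0$ such that whenever $N\ge N_0$ and $A\subset\mathbb{Z}/N\mathbb{Z}$ satisfies $\|1_A-\alpha\|_{U^{k-2}}\le\eta$, then $\Lambda_{\mathbf{a}}(1_A)\ge\rho_{\mathbf{a}}(\alpha)-\epsilon$. *)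

theory Defs
  imports Complex_Main "HOL-Library.Indicator_Function" "HOL-Algebra.Elementary_Groups"
begin

definition mean :: "'b set \<Rightarrow> ('b \<Rightarrow> complex) \<Rightarrow> complex" where
  "mean S f = (\<Sum>x\<in>S. f x) / of_nat (card S)"

(* A finite abelian group is an HOL-Algebra group G, written multiplicatively:
   n \<otimes> inv h is n - h, and d [^] a with an integer exponent a is the multiple a d. *)

definition mult_deriv :: "('g, 'm) monoid_scheme \<Rightarrow> 'g \<Rightarrow> ('g \<Rightarrow> complex) \<Rightarrow> 'g \<Rightarrow> complex" where
  "mult_deriv G h f = (\<lambda>n. f n * cnj (f (n \<otimes>\<^bsub>G\<^esub> inv\<^bsub>G\<^esub> h)))"

(* For s \<ge> 1 the mean below is a nonnegative real number, so that Re loses nothing and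
   the norm is its nonnegative root of order 2^s. *)
definition gowers_norm :: "('g, 'm) monoid_scheme \<Rightarrow> nat \<Rightarrow> ('g \<Rightarrow> complex) \<Rightarrow> real" where
  "gowers_norm G s f =
     root (2 ^ s)
       (Re (mean (carrier G \<times> {hs. set hs \<subseteq> carrier G \<and> length hs = s})
              (\<lambda>(n, hs). foldr (mult_deriv G) hs f n)))"

definition pattern_avg :: "('g, 'm) monoid_scheme \<Rightarrow> int list \<Rightarrow> ('g \<Rightarrow> complex) \<Rightarrow> complex" where
  "pattern_avg G a f =
     mean (carrier G \<times> carrier G)
       (\<lambda>(n, d). \<Prod>i<length a. f (n \<otimes>\<^bsub>G\<^esub> (d [^]\<^bsub>G\<^esub> (a ! i))))"

definition symmetric_pattern :: "int list \<Rightarrow> bool" where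
  "symmetric_pattern a \<longleftrightarrow>
     even (length a) \<and>
     (\<forall>i<length a. \<forall>j<length a.
        a ! i + a ! (length a - 1 - i) = a ! j + a ! (length a - 1 - j))"

(* The admissible lower bounds r for the pattern density of sets A in Z/NZ that are
   U^(k-2)-close to the constant alpha, where k is the length of a (so k \<ge> 3 is
   intended). Here pattern_avg of an indicator function is a real number. *)
definition rho_bound :: "int list \<Rightarrow> real \<Rightarrow> real \<Rightarrow> bool" where
  "rho_bound a \<alpha> r \<longleftrightarrow>
     (\<forall>\<epsilon>>0. \<exists>\<eta>>0. \<exists>N\<^sub>0. \<forall>N::nat. \<forall>A::int set.
        0 < N \<and> N\<^sub>0 \<le> N \<and> A \<subseteq> carrier (integer_mod_group N) \<and>
        gowers_norm (integer_mod_group N) (length a - 2)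
          (\<lambda>n. indicator A n - complex_of_real \<alpha>) \<le> \<eta>
        \<longrightarrow> Re (pattern_avg (integer_mod_group N) a (indicator A)) \<ge> r - \<epsilon>)"

definition rho :: "int list \<Rightarrow> real \<Rightarrow> real" where
  "rho a \<alpha> = (GREATEST r. rho_bound a \<alpha> r)"

end

theory Submission
  imports Defs "HOL-Computational_Algebra.Squarefree" "HOL-Analysis.Convex" "HOL-Real_Asymp.Real_Asymp"
begin

text \<open>
  Let \<open>c\<^sub>i\<close> be integers with \<open>\<Sum> c\<^sub>i P(a\<^sub>i) = 0\<close> for every polynomial \<open>P\<close> of degree at most \<open>k - 2\<close>
  (the weights of a divided difference). Take \<open>N = m p\<close> with \<open>p\<close> a large prime, a bounded
  \<open>m\<close>-periodic function \<open>f\<close>, and the set of \<open>n\<close> for which \<open>n\<^bsup>k-2\<^esup> + w f(n)\<close> reduces modulo \<open>p\<close> into an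
  initial interval of density \<open>\<alpha>\<close>. By Weyl differencing this set is uniform of order \<open>k - 2\<close> as \<open>p\<close>
  grows. If it contains the pattern \<open>n + a\<^sub>i d\<close>, the weights eliminate the polynomial and, for a
  suitable \<open>w\<close>, leave \<open>\<Sum> c\<^sub>i f(n + a\<^sub>i d) = 0\<close> as soon as \<open>f\<close> is bounded by a small multiple of
  \<open>1 / \<alpha>\<close>.

  It remains to find \<open>f\<close> bounded by \<open>E\<^bsup>J\<^esup>\<close>, with period \<open>m \<ge> 4\<^bsup>J\<^sup>2\<^esup>\<close>, for which this relation
  forces \<open>m\<close> to divide \<open>d\<close>. Here \<open>f(n)\<close> encodes, as in Behrend's construction, the squared length
  of the vector of residues of a multiple of \<open>n\<close> modulo \<open>J\<close> coprime numbers, together with the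
  coarse position of the residues. Along a pattern the squared length is a quadratic polynomial
  in \<open>a\<^sub>i\<close>, with positive leading coefficient unless \<open>m\<close> divides \<open>d\<close>, and the relation says that each of its level sets
  has total weight \<open>0\<close>. As no weight vanishes, every level set is a pair of reflected points, so
  that \<open>k\<close> is even and the pattern symmetric.
\<close>

section \<open>Weights annihilating polynomials\<close>

text \<open>Newton's divided difference of the values \<open>g\<close> at the nodes
  \<open>x i, ..., x (i + l)\<close>. The recursive form suits the sign analysis for step functions,
  an induction on the order \<open>l\<close>.\<close>

fun divided_diff :: "(nat \<Rightarrow> rat) \<Rightarrow> nat \<Rightarrow> nat \<Rightarrow> (nat \<Rightarrow> rat) \<Rightarrow> rat" where
  "divided_diff x 0 i g = g i"
| "divided_diff x (Suc l) i g =
     (divided_diff x l (Suc i) g - divided_diff x l i g) / (x (i + Suc l) - x i)"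

lemma divided_diff_weights:
  "\<exists>c. \<forall>g. divided_diff x l i g = (\<Sum>j\<in>{i..i+l}. c j * g j)"
proof (induction l arbitrary: i)
  case 0
  show ?case by (intro exI[of _ "\<lambda>_. 1"]) simp
next
  case (Suc l)
  obtain c where c: "\<And>g. divided_diff x l i g = (\<Sum>j\<in>{i..i+l}. c j * g j)"
    using Suc.IH by blast
  obtain c' where c': "\<And>g. divided_diff x l (Suc i) g = (\<Sum>j\<in>{Suc i..Suc i+l}. c' j * g j)"
    using Suc.IH by blast
  define D where "D = x (i + Suc l) - x i"
  define e where "e j = ((if j = i then 0 else c' j) - (if j = i + Suc l then 0 else c j)) / D" for j
  have "divided_diff x (Suc l) i g = (\<Sum>j\<in>{i..i+Suc l}. e j * g j)" for g
  proof -
    have A: "(\<Sum>j\<in>{i..i+Suc l}. (if j = i then 0 else c' j) * g j) = (\<Sum>j\<in>{Suc i..Suc i+l}. c' j * g j)"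
      by (subst sum.atLeast_Suc_atMost) (auto intro!: sum.cong)
    have B: "(\<Sum>j\<in>{i..i+Suc l}. (if j = i + Suc l then 0 else c j) * g j) = (\<Sum>j\<in>{i..i+l}. c j * g j)"
      by (auto intro!: sum.cong)
    show ?thesis
      unfolding divided_diff.simps c c' A[symmetric] B[symmetric] e_def D_def[symmetric]
      by (simp add: sum_subtractf[symmetric] sum_divide_distrib diff_divide_distrib left_diff_distrib del: sum.cl_ivl_Suc)
  qed
  then show ?case by blast
qed

lemma divided_diff_add:
  "divided_diff x l i (\<lambda>j. g j + h j) = divided_diff x l i g + divided_diff x l i h"
  by (induction l arbitrary: i) (simp_all add: diff_divide_distrib add_divide_distrib)

lemma divided_diff_scale:
  "divided_diff x l i (\<lambda>j. r * g j) = r * divided_diff x l i g"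
  by (induction l arbitrary: i) (simp_all add: right_diff_distrib)

text \<open>An instance of the Leibniz rule: the factor \<open>x j - x i\<close> vanishes at the
  node \<open>x i\<close>, so that node drops out. In the induction step the factor is split as
  \<open>(x j - x (Suc i)) + (x (Suc i) - x i)\<close>.\<close>

lemma divided_diff_shift:
  assumes "\<And>i j. i < j \<Longrightarrow> j < k \<Longrightarrow> x i < x j" "i + Suc l < k"
  shows "divided_diff x (Suc l) i (\<lambda>j. (x j - x i) * g j) = divided_diff x l (Suc i) g"
  using assms(2)
proof (induction l arbitrary: i)
  case 0
  then show ?case using assms(1)[of i "Suc i"] by simp
next
  case (Suc l)
  have lt: "x i < x (i + Suc (Suc l))" "x i < x (Suc i)" 
    using assms(1)[of i "i + Suc (Suc l)"] assms(1)[of i "Suc i"] Suc.prems by auto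
  have lt2: "x (Suc i) < x (Suc i + Suc l)" using assms(1)[of "Suc i" "Suc i + Suc l"] Suc.prems by auto
  have "divided_diff x (Suc l) (Suc i) (\<lambda>j. (x j - x i) * g j)
      = divided_diff x (Suc l) (Suc i) (\<lambda>j. (x j - x (Suc i)) * g j + (x (Suc i) - x i) * g j)"
    by (simp add: algebra_simps del: divided_diff.simps)
  also have "\<dots> = divided_diff x l (Suc (Suc i)) g + (x (Suc i) - x i) * divided_diff x (Suc l) (Suc i) g"
    unfolding divided_diff_add divided_diff_scale using Suc.IH[of "Suc i"] Suc.prems by simp
  finally have A: "divided_diff x (Suc l) (Suc i) (\<lambda>j. (x j - x i) * g j) = \<dots>" .
  have B: "divided_diff x (Suc l) i (\<lambda>j. (x j - x i) * g j) = divided_diff x l (Suc i) g"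
    using Suc.IH[of i] Suc.prems by simp
  define R where "R = divided_diff x (Suc l) (Suc i) g"
  have C: "divided_diff x l (Suc (Suc i)) g - divided_diff x l (Suc i) g = (x (Suc i + Suc l) - x (Suc i)) * R"
    unfolding R_def using lt2 by simp
  have "divided_diff x (Suc (Suc l)) i (\<lambda>j. (x j - x i) * g j) =
     (divided_diff x l (Suc (Suc i)) g + (x (Suc i) - x i) * R - divided_diff x l (Suc i) g) / (x (i + Suc (Suc l)) - x i)"
    by (subst divided_diff.simps(2), subst A, subst B) (simp add: R_def)
  also have "\<dots> = ((x (Suc i + Suc l) - x (Suc i)) * R + (x (Suc i) - x i) * R) / (x (i + Suc (Suc l)) - x i)"
    using C by (simp add: algebra_simps)
  also have "\<dots> = R" using lt by (simp add: field_simps)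
  finally show ?case by (simp only: R_def)
qed

text \<open>Writing \<open>x j ^ Suc e = (x j - x i) * x j ^ e + x i * x j ^ e\<close> lowers the
  exponent; the shift rule lowers the order by one in the first summand only. Constants have
  difference 0 in every positive order.\<close>

lemma divided_diff_power_eq_0:
  assumes "\<And>i j. i < j \<Longrightarrow> j < k \<Longrightarrow> x i < x j" "i + l < k" "e < l"
  shows "divided_diff x l i (\<lambda>j. x j ^ e) = 0"
  using assms(2,3)
proof (induction e arbitrary: i l)
  case 0
  have const: "divided_diff x (Suc l) i (\<lambda>j. 1) = 0" for l i
  proof (induction l arbitrary: i)
    case (Suc l)
    show ?case by (subst divided_diff.simps(2)) (simp only: Suc.IH, simp)
  qed simp
  from 0 show ?case using const[of "l - 1" i] by (cases l) auto
next
  case (Suc e)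
  then obtain l' where l: "l = Suc l'" by (cases l) auto
  have "divided_diff x l i (\<lambda>j. x j ^ Suc e) = divided_diff x l i (\<lambda>j. (x j - x i) * x j ^ e + x i * x j ^ e)"
    by (simp add: algebra_simps del: divided_diff.simps)
  also have "\<dots> = divided_diff x l' (Suc i) (\<lambda>j. x j ^ e) + x i * divided_diff x l i (\<lambda>j. x j ^ e)"
    unfolding divided_diff_add divided_diff_scale l
    using divided_diff_shift[OF assms(1), where i=i and l=l' and g="\<lambda>j. x j ^ e"] Suc.prems l by simp
  also have "\<dots> = 0" using Suc.IH[of "Suc i" l'] Suc.IH[of i l] Suc.prems l by simp
  finally show ?case .
qed

text \<open>On the step function that is 1 for \<open>j < r\<close>, a divided difference is the sum
  of its weights with index below \<open>r\<close>. The two terms that the recursion subtracts have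
  opposite signs, so nothing cancels.\<close>

lemma divided_diff_step_sign:
  assumes "\<And>i j. i < j \<Longrightarrow> j < k \<Longrightarrow> x i < x j" "i + l < k" "0 < l"
  shows "(if i < r \<and> r \<le> i + l
          then (-1) ^ (l + i + 1 - r) * divided_diff x l i (\<lambda>j. if j < r then 1 else 0) > 0
          else divided_diff x l i (\<lambda>j. if j < r then 1 else 0) = 0)"
  using assms(2,3)
proof (induction l arbitrary: i)
  case (Suc l)
  let ?g = "\<lambda>j. if j < r then 1 else 0 :: rat"
  have lt: "x i < x (i + Suc l)" using assms(1)[of i "i + Suc l"] Suc.prems by auto
  show ?case
  proof (cases "l = 0")
    case True
    show ?thesis
    proof (cases "i < r \<and> r \<le> i + 1")
      case t: True
      then have "r = Suc i" by auto
      then show ?thesis using \<open>l = 0\<close> lt by (simp add: field_simps)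
    next
      case False
      then show ?thesis using \<open>l = 0\<close> lt by auto
    qed
  next
    case False
    have I1: "if Suc i < r \<and> r \<le> Suc i + l then (-1) ^ (l + Suc i + 1 - r) * divided_diff x l (Suc i) ?g > 0
      else divided_diff x l (Suc i) ?g = 0" using Suc.IH[of "Suc i"] Suc.prems False by simp
    have I2: "if i < r \<and> r \<le> i + l then (-1) ^ (l + i + 1 - r) * divided_diff x l i ?g > 0
      else divided_diff x l i ?g = 0" using Suc.IH[of "i"] Suc.prems False by simp
    show ?thesis
    proof (cases "i < r \<and> r \<le> i + Suc l")
      case t: True
      define P where "P = (-1 :: rat) ^ (Suc l + i + 1 - r) * divided_diff x l (Suc i) ?g"
      define R where "R = (-1 :: rat) ^ (Suc l + i + 1 - r) * divided_diff x l i ?g"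
      have P: "P \<ge> 0" "Suc i < r \<Longrightarrow> P > 0" using I1 t by (auto simp: P_def split: if_splits)
      have "Suc l + i + 1 - r = Suc (l + i + 1 - r)" using t by linarith
      then have R: "R \<le> 0" "r \<le> i + l \<Longrightarrow> R < 0" using I2 t by (auto simp: R_def split: if_splits)
      \<comment> \<open>One of the two signs is strict: either \<open>Suc i < r\<close>, or
        \<open>r = Suc i \<le> i + l\<close> because \<open>l \<noteq> 0\<close>.\<close>
      have "P - R > 0"
        using P R False t by (cases "Suc i < r") force+
      then have "(P - R) / (x (i + Suc l) - x i) > 0" using lt by simp
      also have "(P - R) / (x (i + Suc l) - x i) = (-1) ^ (Suc l + i + 1 - r) * divided_diff x (Suc l) i ?g"
        by (simp add: P_def R_def right_diff_distrib)
      finally show ?thesis using t by simp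
    next
      case f: False
      then have "divided_diff x l (Suc i) ?g = 0" "divided_diff x l i ?g = 0" using I1 I2 by (auto split: if_splits)
      then show ?thesis using f by auto
    qed
  qed
qed simp

lemma common_denominator:
  assumes "finite S"
  shows "\<exists>D>0. \<forall>i\<in>S. \<exists>z. rat_of_int z = rat_of_int D * (c i :: rat)"
  using assms
proof induction
  case empty
  show ?case by (intro exI[of _ 1]) simp
next
  case (insert s S)
  then obtain D where D: "D > 0" "\<forall>i\<in>S. \<exists>z. rat_of_int z = rat_of_int D * c i" by auto
  obtain u v where uv: "c s = Fract u v" "v > 0" "coprime u v" by (cases "c s") auto
  have "\<exists>z. rat_of_int z = rat_of_int (D * v) * c i" if "i \<in> insert s S" for i
  proof (cases "i = s")
    case True
    then show ?thesis using uv by (intro exI[of _ "D * u"]) (simp add: Fract_of_int_quotient)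
  next
    case False
    then have "i \<in> S" using that by simp
    from bspec[OF D(2) this] obtain z where "rat_of_int z = rat_of_int D * c i" by (elim exE)
    then show ?thesis by (intro exI[of _ "z * v"]) simp
  qed
  then show ?case using D uv by (intro exI[of _ "D * v"]) auto
qed

text \<open>These are the weights of the divided difference of order \<open>k - 1\<close> at the
  \<open>a i\<close>, cleared of denominators. Their proper partial sums alternate in sign, as
  divided differences of step functions; hence neither they nor the weights themselves vanish. The
  partial sums serve later to exclude wrap-around.\<close>

lemma annihilating_weights:
  fixes a :: "nat \<Rightarrow> int"
  assumes mono: "\<And>i j. i < j \<Longrightarrow> j < k \<Longrightarrow> a i < a j" and k: "k \<ge> 2"
  obtains c :: "nat \<Rightarrow> int"
  where "\<And>e. e < k - 1 \<Longrightarrow> (\<Sum>i<k. c i * a i ^ e) = 0"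
    and "\<And>r. 0 < r \<Longrightarrow> r < k \<Longrightarrow> (\<Sum>i<r. c i) \<noteq> 0"
    and "\<And>i. i < k \<Longrightarrow> c i \<noteq> 0"
proof -
  define x where "x i = rat_of_int (a i)" for i
  have xm: "\<And>i j. i < j \<Longrightarrow> j < k \<Longrightarrow> x i < x j" using mono by (simp add: x_def)
  obtain w where w0: "\<And>g. divided_diff x (k-1) 0 g = (\<Sum>j\<in>{0..0+(k-1)}. w j * g j)"
    using divided_diff_weights by blast
  have "{0..0+(k-1)} = {..<k}" using k by auto
  then have w: "\<And>g. divided_diff x (k-1) 0 g = (\<Sum>j<k. w j * g j)" using w0 by simp
  obtain D where D: "D > 0" "\<forall>i\<in>{..<k}. \<exists>z. rat_of_int z = rat_of_int D * w i"
    using common_denominator[of "{..<k}" w] by auto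
  then obtain c where c: "\<And>i. i < k \<Longrightarrow> rat_of_int (c i) = rat_of_int D * w i"
    by (metis lessThan_iff)
  have cs: "rat_of_int (\<Sum>i<r. c i) = rat_of_int D * divided_diff x (k-1) 0 (\<lambda>j. if j < r then 1 else 0)"
    if "r \<le> k" for r
  proof -
    have "(\<Sum>j<k. w j * (if j < r then 1 else 0)) = (\<Sum>j<r. w j)"
      using that by (intro sum.mono_neutral_cong_right) auto
    then show ?thesis unfolding w using that c by (simp add: sum_distrib_left)
  qed
  have sgn: "(-1) ^ (k - r) * (\<Sum>i<r. c i) > 0" if "0 < r" "r < k" for r
  proof -
    have "(-1) ^ (k - r) * divided_diff x (k-1) 0 (\<lambda>j. if j < r then 1 else 0) > 0"
      using divided_diff_step_sign[where k=k and x=x and i=0 and l="k-1" and r=r, OF xm] that k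
      by (auto split: if_splits)
    then have "rat_of_int D * ((-1) ^ (k - r) * divided_diff x (k-1) 0 (\<lambda>j. if j < r then 1 else 0)) > 0"
      using D by simp
    then have "rat_of_int ((-1) ^ (k - r) * (\<Sum>i<r. c i)) > 0"
      using cs[of r] that by (simp add: mult_ac del: of_int_sum)
    then show ?thesis by linarith
  qed
  have tot: "(\<Sum>i<k. c i) = 0"
  proof -
    have "divided_diff x (k-1) 0 (\<lambda>j. if j < k then 1 else 0) = 0"
      using divided_diff_step_sign[where k=k and x=x and i=0 and l="k-1" and r=k, OF xm] k
      by (auto split: if_splits)
    then have "rat_of_int (\<Sum>i<k. c i) = 0" using cs[of k] by simp
    then show ?thesis by linarith
  qed
  show ?thesis
  proof
    fix e assume "e < k - 1"
    then have "divided_diff x (k-1) 0 (\<lambda>j. x j ^ e) = 0"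
      using divided_diff_power_eq_0[where k=k, OF xm] k by simp
    then have "rat_of_int D * (\<Sum>i<k. w i * x i ^ e) = 0" unfolding w by simp
    then have "rat_of_int (\<Sum>i<k. c i * a i ^ e) = 0"
      using c by (simp add: sum_distrib_left x_def mult_ac)
    then show "(\<Sum>i<k. c i * a i ^ e) = 0" by linarith
  next
    fix r assume "0 < r" "r < k"
    then show "(\<Sum>i<r. c i) \<noteq> 0" using sgn[of r] by auto
  next
    fix i assume i: "i < k"
    consider "i = 0" | "0 < i" "Suc i < k" | "0 < i" "Suc i = k" using i by linarith
    then show "c i \<noteq> 0"
    proof cases
      case 1
      then show ?thesis using sgn[of 1] k by auto
    next
      \<comment> \<open>The weight is the difference of two consecutive partial sums, which have
        opposite signs.\<close>
      case 2
      have "k - i = Suc (k - Suc i)" using 2 by simp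
      then show ?thesis using sgn[of i] sgn[of "Suc i"] 2 by (auto simp: algebra_simps)
    next
      case 3
      then show ?thesis using sgn[of i] tot by auto
    qed
  qed
qed

section \<open>Coprime moduli\<close>

text \<open>Following Erdos: an integer is determined by its square part and the set of primes dividing its
  squarefree part, so there are at most \<open>\<surd>x \<cdot> 2\<^bsup>\<pi>(x)\<^esup>\<close> integers up to \<open>x\<close>.\<close>

lemma card_primes_le:
  "t \<le> card {p::nat. prime p \<and> p \<le> 4 ^ t}"
proof -
  define P where "P = {p::nat. prime p \<and> p \<le> 4 ^ t}"
  have fP: "finite P" unfolding P_def by (rule finite_subset[of _ "{..4^t}"]) auto
  define \<phi> where "\<phi> n = (square_part n, prime_factors (squarefree_part n))" for n :: nat
  have "inj_on \<phi> {1..4^t}"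
  proof (rule inj_onI)
    fix x y :: nat assume xy: "x \<in> {1..4^t}" "y \<in> {1..4^t}" "\<phi> x = \<phi> y"
    have sf: "w = \<Prod>(prime_factors w)" if "squarefree w" "w \<noteq> 0" for w :: nat
    proof -
      from that(2) have "(\<Prod>p\<in>prime_factors w. p ^ multiplicity p w) = w"
        using prod_prime_factors[of w] by simp
      moreover have "multiplicity p w = 1" if "p \<in> prime_factors w" for p
        using squarefree_factorial_semiring'[of w] \<open>squarefree w\<close> \<open>w \<noteq> 0\<close> that by auto
      ultimately show ?thesis by simp
    qed
    have "squarefree_part x = squarefree_part y" 
      using sf[of "squarefree_part x"] sf[of "squarefree_part y"] xy(3) by (simp add: \<phi>_def)
    then show "x = y" using xy(3) squarefree_decompose[of x] squarefree_decompose[of y] by (auto simp: \<phi>_def)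
  qed
  \<comment> \<open>Zero is removed so that the square part takes at most \<open>2 ^ t\<close>
    values, as the cancellation against \<open>4 ^ t = 2 ^ t * 2 ^ t\<close> demands.\<close>
  moreover have "\<phi> ` {1..4^t} \<subseteq> {..2^t} \<times> Pow P - {0} \<times> Pow P"
  proof
    fix z assume "z \<in> \<phi> ` {1..4^t}"
    then obtain n where n: "z = \<phi> n" "n \<ge> 1" "n \<le> 4^t" by auto
    have "square_part n ^ 2 \<le> n" using n by (intro dvd_imp_le) auto
    also have "\<dots> \<le> (2^2)^t" using n by simp
    also have "(2^2)^t = ((2::nat)^t)^2" by (simp only: power_mult[symmetric] mult.commute)
    finally have "square_part n \<le> 2 ^ t" by (rule power2_le_imp_le) simp
    moreover have "p \<le> 4 ^ t" if "p \<in> prime_factors (squarefree_part n)" for p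
    proof -
      have "p dvd n" using that squarefree_decompose[of n] by (metis dvd_mult2 in_prime_factors_iff)
      then have "p \<le> n" using n by (intro dvd_imp_le) auto
      then show ?thesis using n by simp
    qed
    ultimately show "z \<in> {..2^t} \<times> Pow P - {0} \<times> Pow P" using n by (auto simp: \<phi>_def P_def)
  qed
  moreover have "{..2^t} \<times> Pow P - {0} \<times> Pow P = {1..2^t::nat} \<times> Pow P" by auto
  ultimately have "card {1..4^t::nat} \<le> card ({1..2^t::nat} \<times> Pow P)"
    using fP by (metis card_inj_on_le finite_atLeastAtMost finite_Pow_iff finite_SigmaI)
  then have "(4::nat)^t \<le> 2^t * 2 ^ card P" using fP by (simp add: card_cartesian_product card_Pow)
  also have "(4::nat)^t = 2^t * 2^t" by (simp add: power_mult_distrib[symmetric])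
  finally have "(2::nat)^t \<le> 2 ^ card P" by simp
  then show ?thesis by (simp add: P_def)
qed

text \<open>The least exponent with \<open>X \<le> q ^ e\<close> works: the previous power is below
  \<open>X\<close>, and one more factor \<open>q \<le> X\<close> stays within
  \<open>X\<^sup>2\<close>.\<close>

lemma power_in_range:
  fixes q X :: nat
  assumes "2 \<le> q" "q \<le> X"
  shows "\<exists>e. X \<le> q ^ e \<and> q ^ e \<le> X\<^sup>2"
proof -
  have "X < 2 ^ X" by (rule less_exp)
  also have "\<dots> \<le> q ^ X" using assms by (simp add: power_mono)
  finally have ex: "X \<le> q ^ X" by simp
  define e where "e = (LEAST e. X \<le> q ^ e)"
  have e: "X \<le> q ^ e" unfolding e_def by (rule LeastI[of "\<lambda>e. X \<le> q ^ e", OF ex])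
  have "e \<noteq> 0" using e assms by (cases e) auto
  then obtain e' where e': "e = Suc e'" by (cases e) auto
  then have "q ^ e' < X" using not_less_Least[of e' "\<lambda>e. X \<le> q ^ e"] by (simp add: e_def)
  then have "q ^ e \<le> X\<^sup>2" using assms e' by (simp add: power2_eq_square mult_mono)
  then show ?thesis using e by blast
qed

text \<open>Among the at least \<open>J + Q\<close> primes up to \<open>4 ^ (J + Q)\<close>, at most
  \<open>Q\<close> divide \<open>Q\<close>; \<open>J\<close> of the others are raised to powers of
  comparable size. The lower bound makes the product of the moduli at least
  \<open>4 ^ (J * J)\<close>, and the upper bound keeps the squared lengths of residue vectors
  exponential in \<open>J\<close>.\<close>

lemma coprime_moduli:
  fixes J Q :: nat
  assumes "Q > 0"
  obtains M :: "nat \<Rightarrow> nat"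
  where "\<And>j. j < J \<Longrightarrow> 4 ^ (J + Q) \<le> M j"
    and "\<And>j. j < J \<Longrightarrow> M j \<le> (4 ^ (J + Q))\<^sup>2"
    and "\<And>j. j < J \<Longrightarrow> coprime (M j) Q"
    and "\<And>i j. i < J \<Longrightarrow> j < J \<Longrightarrow> i \<noteq> j \<Longrightarrow> coprime (M i) (M j)"
proof -
  define X :: nat where "X = 4 ^ (J + Q)"
  define P where "P = {p::nat. prime p \<and> p \<le> X} - {p. p dvd Q}"
  have fin: "finite {p::nat. prime p \<and> p \<le> X}" by (rule finite_subset[of _ "{..X}"]) auto
  have sub: "{p. p dvd Q} \<subseteq> {1..Q}" using assms by (auto dest: dvd_imp_le intro: Suc_leI dvd_pos_nat)
  have "card {p. p dvd Q} \<le> Q" using card_mono[OF _ sub] by simp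
  moreover have "J + Q \<le> card {p::nat. prime p \<and> p \<le> X}" unfolding X_def by (rule card_primes_le)
  moreover have "card {p::nat. prime p \<and> p \<le> X} - card {p. p dvd Q} \<le> card P"
    unfolding P_def by (rule diff_card_le_card_Diff) (use finite_subset[OF sub] in auto)
  ultimately have "J \<le> card P" by linarith
  then obtain S where S: "S \<subseteq> P" "card S = J" "finite S" by (metis obtain_subset_with_card_n)
  then obtain h where h: "bij_betw h {0..<J} S" using ex_bij_betw_nat_finite by blast
  have hP: "h j \<in> P" if "j < J" for j using h S that by (auto simp: bij_betw_def)
  define M where "M j = h j ^ (SOME e. X \<le> h j ^ e \<and> h j ^ e \<le> X\<^sup>2)" for j
  have M: "X \<le> M j \<and> M j \<le> X\<^sup>2" if "j < J" for j
    unfolding M_def using someI_ex[OF power_in_range[of "h j" X]] hP[OF that] by (auto simp: P_def prime_ge_2_nat)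
  show ?thesis
  proof
    fix j assume j: "j < J"
    show "4 ^ (J + Q) \<le> M j" "M j \<le> (4 ^ (J + Q))\<^sup>2" using M[OF j] by (auto simp: X_def)
    have "coprime (h j) Q" using hP[OF j] by (auto simp: P_def intro: prime_imp_coprime)
    then show "coprime (M j) Q" by (simp add: M_def)
  next
    fix i j assume ij: "i < J" "j < J" "i \<noteq> j"
    then have "h i \<noteq> h j" using h by (auto simp: bij_betw_def inj_on_def)
    then have "coprime (h i) (h j)" using hP[of i] hP[of j] ij by (auto simp: P_def intro: primes_coprime)
    then show "coprime (M i) (M j)" by (simp add: M_def)
  qed
qed

lemma prod_dvd_of_coprime:
  fixes M :: "nat \<Rightarrow> nat" and d :: int
  assumes "\<And>i j. i < J \<Longrightarrow> j < J \<Longrightarrow> i \<noteq> j \<Longrightarrow> coprime (M i) (M j)"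
    and "\<And>j. j < J \<Longrightarrow> int (M j) dvd d"
  shows "int (\<Prod>j<J. M j) dvd d"
  using assms
proof (induction J)
  case (Suc J)
  have "coprime (\<Prod>j<J. M j) (M J)" using Suc.prems(1) by (intro prod_coprime_left) auto
  then have "coprime (int (\<Prod>j<J. M j)) (int (M J))" by (simp add: coprime_int_iff del: of_nat_prod)
  moreover have "int (\<Prod>j<J. M j) dvd d" using Suc by simp
  ultimately show ?case using Suc.prems(2)[of J] by (simp add: divides_mult del: of_nat_prod)
qed simp

section \<open>Colours of patterns\<close>

text \<open>As in Lagrange interpolation, the polynomial vanishing at all the values except
  \<open>x\<close> has degree below \<open>k\<close>. The moments therefore show that the weights on
  each level set \<open>v i = x\<close> sum to 0.\<close>

lemma sum_eq_0_if_moments_vanish: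
  fixes c v :: "nat \<Rightarrow> int"
  assumes "\<And>e. e < k \<Longrightarrow> (\<Sum>i<k. c i * v i ^ e) = 0"
  shows "(\<Sum>i<k. c i * g (v i)) = 0"
proof -
  have moments: "(\<Sum>i<k. c i * v i ^ e * (\<Prod>u\<in>V. v i - u)) = 0"
    if "finite V" "e + card V < k" for V e
    using that
  proof (induction V arbitrary: e)
    case empty
    then show ?case using assms[of e] by simp
  next
    case (insert u V)
    have "(\<Sum>i<k. c i * v i ^ e * (\<Prod>w\<in>insert u V. v i - w)) =
      (\<Sum>i<k. c i * v i ^ Suc e * (\<Prod>w\<in>V. v i - w)) - u * (\<Sum>i<k. c i * v i ^ e * (\<Prod>w\<in>V. v i - w))"
      using insert.hyps by (simp add: sum_distrib_left sum_subtractf[symmetric] algebra_simps)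
    also have "\<dots> = 0" using insert.IH[of e] insert.IH[of "Suc e"] insert.prems insert.hyps by simp
    finally show ?case .
  qed
  have single: "(\<Sum>i\<in>{i. i < k \<and> v i = x}. c i) = 0" for x
  proof (cases "x \<in> v ` {..<k}")
    case False
    then have "{i. i < k \<and> v i = x} = {}" by auto
    then show ?thesis by (simp only: sum.empty)
  next
    case True
    define V where "V = v ` {..<k} - {x}"
    have "card V < card (v ` {..<k})" unfolding V_def using True by (intro psubset_card_mono) auto
    also have "\<dots> \<le> k" using card_image_le[of "{..<k}" v] by simp
    finally have "(\<Sum>i<k. c i * (\<Prod>u\<in>V. v i - u)) = 0" using moments[of V 0] by (simp add: V_def)
    also have "(\<Sum>i<k. c i * (\<Prod>u\<in>V. v i - u)) = (\<Sum>i\<in>{i. i < k \<and> v i = x}. c i * (\<Prod>u\<in>V. x - u))"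
    proof (rule sum.mono_neutral_cong_right)
      show "\<forall>i\<in>{..<k} - {i. i < k \<and> v i = x}. c i * (\<Prod>u\<in>V. v i - u) = 0"
        by (auto simp: V_def intro!: prod_zero)
    qed auto
    also have "\<dots> = (\<Sum>i\<in>{i. i < k \<and> v i = x}. c i) * (\<Prod>u\<in>V. x - u)" by (simp add: sum_distrib_right)
    finally show ?thesis by (auto simp: V_def)
  qed
  have "(\<Sum>i<k. c i * g (v i)) = (\<Sum>x\<in>v ` {..<k}. \<Sum>i\<in>{i. i \<in> {..<k} \<and> v i = x}. c i * g (v i))"
    by (rule sum.image_gen) simp
  also have "\<dots> = (\<Sum>x\<in>v ` {..<k}. (\<Sum>i\<in>{i. i < k \<and> v i = x}. c i) * g x)"
    by (auto simp: sum_distrib_right intro!: sum.cong)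
  finally show ?thesis by (simp add: single)
qed

text \<open>The digits are signed: a multiple of \<open>T\<close> below \<open>T\<close> in absolute
  value is 0, which peels them off from the lowest upwards.\<close>

lemma digits_eq_0:
  fixes e :: "nat \<Rightarrow> int"
  assumes "(\<Sum>i<n. T ^ i * e i) = 0" "\<And>i. i < n \<Longrightarrow> \<bar>e i\<bar> < T" "i < n"
  shows "e i = 0"
  using assms
proof (induction n arbitrary: e i)
  case (Suc n)
  have T: "T > 0" using Suc.prems(2)[of 0] by simp
  have s: "e 0 + T * (\<Sum>i<n. T ^ i * e (Suc i)) = 0"
    using Suc.prems(1) by (simp add: sum.lessThan_Suc_shift sum_distrib_left mult_ac del: sum.lessThan_Suc)
  then have "T dvd e 0" by (metis dvd_add_triv_right_iff dvd_0_right dvd_triv_left dvd_add_left_iff)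
  then have e0: "e 0 = 0" using Suc.prems(2)[of 0] by (simp add: dvd_imp_le_int zdvd_not_zless)
      (metis abs_dvd_iff dvd_abs_iff linorder_not_less zdvd_imp_le zero_less_abs_iff)
  then have "(\<Sum>i<n. T ^ i * e (Suc i)) = 0" using s T by simp
  then have "e (Suc i) = 0" if "i < n" for i using Suc.IH[of "\<lambda>i. e (Suc i)" i] Suc.prems(2) that by auto
  then show ?case using e0 Suc.prems(3) by (cases i) auto
qed simp

text \<open>The code \<open>\<phi>\<close> has the powers of the colour as digits in base \<open>T\<close>, so that the single relation
  on codes forces all moments of the colours to vanish.\<close>

lemma colour_code:
  fixes c :: "nat \<Rightarrow> int" and R k :: nat
  assumes "(\<Sum>i<k. c i) = 0" "k \<ge> 1"
  shows "\<exists>\<phi> :: nat \<Rightarrow> int.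
     (\<forall>v<R. 0 \<le> \<phi> v \<and> \<phi> v \<le> int k * ((\<Sum>i<k. \<bar>c i\<bar>) + 1) ^ k * int R ^ (k * k + k)) \<and>
     (\<forall>v g. (\<forall>i<k. v i < R) \<longrightarrow> (\<Sum>i<k. c i * \<phi> (v i)) = 0 \<longrightarrow> (\<Sum>i<k. c i * g (v i)) = 0)"
proof -
  define C where "C = (\<Sum>i<k. \<bar>c i\<bar>)"
  have C: "C \<ge> 0" by (simp add: C_def sum_nonneg)
  \<comment> \<open>\<open>T\<close> exceeds in absolute value every moment
    \<open>\<Sum>i<k. c i * int (v i) ^ e\<close> with \<open>1 \<le> e < k\<close>, so these
    moments can be read off as digits. The powers in the code start at 1 because the moment of order
    0 vanishes by assumption.\<close>
  define T where "T = C * int R ^ k + 1"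
  define \<phi> where "\<phi> v = (\<Sum>m<k-1. T ^ m * int v ^ Suc m)" for v
  have bound: "0 \<le> \<phi> v \<and> \<phi> v \<le> int k * ((\<Sum>i<k. \<bar>c i\<bar>) + 1) ^ k * int R ^ (k * k + k)"
    if v: "v < R" for v
  proof -
  have T: "1 \<le> T" using C by (simp add: T_def)
  have T2: "T \<le> (C + 1) * int R ^ k" using C v by (simp add: T_def algebra_simps)
  have "\<phi> v \<le> (\<Sum>m<k-1. T ^ k * int R ^ k)"
    unfolding \<phi>_def
  proof (rule sum_mono)
    fix m assume m: "m \<in> {..<k-1}"
    have "int v ^ Suc m \<le> int R ^ Suc m" using v by (intro power_mono) auto
    also have "\<dots> \<le> int R ^ k" using v m by (intro power_increasing) auto
    finally show "T ^ m * int v ^ Suc m \<le> T ^ k * int R ^ k"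
      using m T by (intro mult_mono power_increasing) auto
  qed
  also have "\<dots> \<le> int k * T ^ k * int R ^ k" using T by (simp add: mult_right_mono)
  also have "\<dots> \<le> int k * ((C + 1) * int R ^ k) ^ k * int R ^ k"
    using T2 T by (intro mult_right_mono mult_left_mono power_mono) auto
  also have "\<dots> = int k * (C + 1) ^ k * int R ^ (k * k + k)"
    by (simp add: power_mult_distrib power_add power_mult mult_ac)
  finally show "0 \<le> \<phi> v \<and> \<phi> v \<le> int k * ((\<Sum>i<k. \<bar>c i\<bar>) + 1) ^ k * int R ^ (k * k + k)"
    using T by (simp add: C_def \<phi>_def sum_nonneg)
  qed
  have separate: "(\<Sum>i<k. c i * g (v i)) = 0"
    if v: "\<forall>i<k. v i < R" and z: "(\<Sum>i<k. c i * \<phi> (v i)) = 0" for v :: "nat \<Rightarrow> nat" and g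
  proof -
  have "(\<Sum>m<k-1. T ^ m * (\<Sum>i<k. c i * int (v i) ^ Suc m)) = 0"
    using z by (simp add: \<phi>_def sum_distrib_left mult_ac sum.swap[of _ "{..<k}"])
  moreover have "\<bar>\<Sum>i<k. c i * int (v i) ^ Suc m\<bar> < T" if "m < k - 1" for m
  proof -
    have "\<bar>\<Sum>i<k. c i * int (v i) ^ Suc m\<bar> \<le> (\<Sum>i<k. \<bar>c i * int (v i) ^ Suc m\<bar>)" by (rule sum_abs)
    also have "\<dots> \<le> (\<Sum>i<k. \<bar>c i\<bar> * int R ^ k)"
    proof (rule sum_mono)
      fix i assume i: "i \<in> {..<k}"
      have "int (v i) ^ Suc m \<le> int R ^ Suc m" using v i by (intro power_mono) (auto intro: less_imp_le)
      also have "\<dots> \<le> int R ^ k" using v i that by (intro power_increasing) (auto simp: Suc_le_eq)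
      finally show "\<bar>c i * int (v i) ^ Suc m\<bar> \<le> \<bar>c i\<bar> * int R ^ k"
        by (simp add: abs_mult mult_left_mono del: power_Suc)
    qed
    finally show ?thesis by (simp add: T_def C_def sum_distrib_right)
  qed
  ultimately have "(\<Sum>i<k. c i * int (v i) ^ Suc m) = 0" if "m < k - 1" for m
    using digits_eq_0[of T "\<lambda>m. (\<Sum>i<k. c i * int (v i) ^ Suc m)" "k - 1" m] that by blast
  then have "(\<Sum>i<k. c i * int (v i) ^ e) = 0" if "e < k" for e
    using that assms(1) by (cases e) auto
  then show "(\<Sum>i<k. c i * g (v i)) = 0"
    using sum_eq_0_if_moments_vanish[of k c "\<lambda>i. int (v i)" "\<lambda>x. g (nat x)"] by simp
  qed
  show ?thesis using bound separate by blast
qed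

section \<open>Residues along a pattern, and reflections\<close>

lemma abs_diff_less_if_div_eq:
  fixes x y M :: int
  assumes "M > 0" "x div M = y div M"
  shows "\<bar>x - y\<bar> < M"
proof -
  have "M * (x div M) = M * (y div M)" using assms by simp
  moreover have "x = M * (x div M) + x mod M" "y = M * (y div M) + y mod M" by simp_all
  moreover have "0 \<le> x mod M" "x mod M < M" "0 \<le> y mod M" "y mod M < M" using assms by auto
  ultimately show ?thesis by linarith
qed

text \<open>Cells have width \<open>M / K \<le> M / 2\<close>, so the residues at \<open>0\<close>
  and at \<open>t\<close> differ by less than \<open>M / 2\<close>, and the drift
  \<open>t * \<sigma>\<close> is at most \<open>M / 2\<close>. Their discrepancy is a multiple of
  \<open>M\<close> smaller than \<open>M\<close>, hence 0. The residue at \<open>t'\<close> then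
  lies between the two ends and shares their cell.\<close>

lemma no_wrap:
  fixes M K W x \<sigma> t t' :: int
  assumes M: "M > 0" and K: "K \<ge> 2" and \<sigma>: "2 * W * \<bar>\<sigma>\<bar> \<le> M" and t: "0 \<le> t'" "t' \<le> t" "t \<le> W"
    and cell: "(K * ((x + t * \<sigma>) mod M)) div M = (K * (x mod M)) div M"
  shows "(x + t' * \<sigma>) mod M = x mod M + t' * \<sigma>"
    and "(K * ((x + t' * \<sigma>) mod M)) div M = (K * (x mod M)) div M"
proof -
  define z where "z = x mod M"
  define zt where "zt = (x + t * \<sigma>) mod M"
  have z: "0 \<le> z" "z < M" and zt: "0 \<le> zt" "zt < M" using M by (auto simp: z_def zt_def)
  have "\<bar>K * zt - K * z\<bar> < M" using cell M by (intro abs_diff_less_if_div_eq) (auto simp: z_def zt_def)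
  moreover have "\<bar>K * zt - K * z\<bar> = K * \<bar>zt - z\<bar>" using K by (simp add: abs_mult flip: right_diff_distrib)
  ultimately have "K * \<bar>zt - z\<bar> < M" by simp
  moreover have "2 * \<bar>zt - z\<bar> \<le> K * \<bar>zt - z\<bar>" using K by (intro mult_right_mono) auto
  ultimately have "2 * \<bar>zt - z\<bar> < M" by linarith
  moreover have ts: "2 * \<bar>t * \<sigma>\<bar> \<le> M"
  proof -
    have "2 * \<bar>t * \<sigma>\<bar> \<le> 2 * W * \<bar>\<sigma>\<bar>" using t by (simp add: abs_mult mult_right_mono)
    then show ?thesis using \<sigma> by linarith
  qed
  moreover have "\<bar>zt - z - t * \<sigma>\<bar> \<le> \<bar>zt - z\<bar> + \<bar>t * \<sigma>\<bar>" by (rule abs_triangle_ineq4)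
  moreover have "w < M" if "2 * u < M" "2 * v \<le> M" "w \<le> u + v" for u v w :: int
    using that by linarith
  ultimately have lt: "\<bar>zt - z - t * \<sigma>\<bar> < M" by blast
  have "zt - z - t * \<sigma> = M * (x div M - (x + t * \<sigma>) div M)"
    unfolding z_def zt_def by (simp add: minus_mult_div_eq_mod[symmetric] algebra_simps)
  then have "M dvd zt - z - t * \<sigma>" by simp
  then have zeq: "zt = z + t * \<sigma>" using lt by (metis dvd_imp_le_int abs_of_pos M linorder_not_less eq_iff_diff_eq_0 diff_diff_eq)
  have btw: "min z zt \<le> z + t' * \<sigma> \<and> z + t' * \<sigma> \<le> max z zt"
  proof (cases "\<sigma> \<ge> 0")
    case True
    then have "0 \<le> t' * \<sigma>" "t' * \<sigma> \<le> t * \<sigma>" using t by (auto intro: mult_right_mono)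
    then show ?thesis using zeq by linarith
  next
    case False
    then have "t' * \<sigma> \<le> 0" "t * \<sigma> \<le> t' * \<sigma>" using t by (auto intro: mult_right_mono_neg simp: mult_le_0_iff)
    then show ?thesis using zeq by linarith
  qed
  then have "0 \<le> z + t' * \<sigma>" "z + t' * \<sigma> < M" using z zt by linarith+
  then have "(z + t' * \<sigma>) mod M = z + t' * \<sigma>" by simp
  moreover have "(z + t' * \<sigma>) mod M = (x + t' * \<sigma>) mod M" by (simp add: z_def mod_simps)
  ultimately show eq: "(x + t' * \<sigma>) mod M = x mod M + t' * \<sigma>" by (simp add: z_def)
  have "(K * min z zt) div M \<le> (K * (z + t' * \<sigma>)) div M" "(K * (z + t' * \<sigma>)) div M \<le> (K * max z zt) div M"
    using btw M K by (auto intro!: zdiv_mono1 mult_left_mono)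
  moreover have "(K * min z zt) div M = (K * z) div M" "(K * max z zt) div M = (K * z) div M"
    using cell by (auto simp: min_def max_def z_def zt_def)
  ultimately show "(K * ((x + t' * \<sigma>) mod M)) div M = (K * (x mod M)) div M"
    using eq by (simp add: z_def)
qed

text \<open>Sending \<open>x\<close> to \<open>s - x\<close> permutes \<open>set a\<close> and
  reverses the order, so \<open>a\<close> is its own reflected reversal, as a set has only one
  increasing enumeration. In odd length the middle entry would be its own only partner, against
  \<open>j \<noteq> i\<close>.\<close>

lemma symmetric_if_reflections:
  fixes a :: "int list"
  assumes "sorted_wrt (<) a"
    and refl: "\<And>i. i < length a \<Longrightarrow> \<exists>j<length a. j \<noteq> i \<and> a ! i + a ! j = s"
  shows "symmetric_pattern a"
proof -
  have dist: "distinct a" and sorted: "sorted a"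
    using assms(1) by (auto simp: strict_sorted_iff)
  have sub: "(\<lambda>x. s - x) ` set a \<subseteq> set a"
  proof
    fix y assume "y \<in> (\<lambda>x. s - x) ` set a"
    then obtain i where i: "i < length a" "y = s - a ! i" by (auto simp: in_set_conv_nth)
    then obtain j where "j < length a" "a ! i + a ! j = s" using refl by blast
    then have "y = a ! j" using i by simp
    then show "y \<in> set a" using \<open>j < length a\<close> by simp
  qed
  have "set a = (\<lambda>x. s - x) ` set a"
  proof
    show "set a \<subseteq> (\<lambda>x. s - x) ` set a"
    proof
      fix y assume "y \<in> set a"
      then have "s - y \<in> set a" using sub by auto
      then show "y \<in> (\<lambda>x. s - x) ` set a" by (intro image_eqI[of _ _ "s - y"]) auto
    qed
  qed (rule sub)
  moreover have "sorted (map (\<lambda>x. s - x) (rev a))"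
    using sorted by (auto simp: sorted_iff_nth_mono rev_nth intro!: sorted_nth_mono)
  moreover have "distinct (map (\<lambda>x. s - x) (rev a))" using dist by (simp add: distinct_map inj_on_def)
  ultimately have eq: "a = map (\<lambda>x. s - x) (rev a)"
    using sorted dist by (intro sorted_distinct_set_unique) auto
  have sum: "a ! i + a ! (length a - 1 - i) = s" if "i < length a" for i
    using arg_cong[OF eq, of "\<lambda>l. l ! i"] that by (simp add: rev_nth)
  have "even (length a)"
  proof (rule ccontr)
    assume "odd (length a)"
    then obtain q where q: "length a = 2 * q + 1" by (auto elim: oddE)
    have "a ! q + a ! q = s" using sum[of q] q by simp
    moreover obtain j where j: "j < length a" "j \<noteq> q" "a ! q + a ! j = s" using refl[of q] q by auto
    ultimately have "a ! j = a ! q" by simp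
    then show False using j q dist by (simp add: nth_eq_iff_index_eq)
  qed
  then show ?thesis using sum by (simp add: symmetric_pattern_def)
qed

text \<open>The first two components are the cells, \<open>K\<close> per modulus, of the residues of
  \<open>n\<close> and of \<open>Q * n\<close>; the third is Behrend's squared length.
  \<open>restrict\<close> fixes the values outside \<open>{..<J}\<close>, so that equality of
  colours means agreement for \<open>j < J\<close> and the colours form a finite set.\<close>

definition colour :: "nat \<Rightarrow> (nat \<Rightarrow> int) \<Rightarrow> int \<Rightarrow> int \<Rightarrow> int \<Rightarrow> (nat \<Rightarrow> int) \<times> (nat \<Rightarrow> int) \<times> int" where
  "colour J M Q K n =
     (restrict (\<lambda>j. (K * (n mod M j)) div M j) {..<J},
      restrict (\<lambda>j. (K * ((Q * n) mod M j)) div M j) {..<J},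
      \<Sum>j<J. ((Q * n) mod M j)\<^sup>2)"

text \<open>Coincident cells at \<open>n\<close> force \<open>Q d\<close> to be small modulo every \<open>M j\<close>; then the cells of \<open>Q n\<close> and the
  non-vanishing of the partial sums exclude a wrap-around, the third component becomes a quadratic
  polynomial along the pattern, and it takes each value at most twice unless \<open>Q d\<close> vanishes.\<close>

lemma colour_rigid:
  fixes a :: "int list" and c :: "nat \<Rightarrow> int" and M :: "nat \<Rightarrow> int" and K Q n d :: int
  assumes sorted: "sorted_wrt (<) a" and k: "k = length a" "k \<ge> 2"
    and asym: "\<not> symmetric_pattern a"
    and total: "(\<Sum>i<k. c i) = 0"
    and partial: "\<And>r. 0 < r \<Longrightarrow> r < k \<Longrightarrow> (\<Sum>i<r. c i) \<noteq> 0"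
    and nonzero: "\<And>i. i < k \<Longrightarrow> c i \<noteq> 0"
    and M: "\<And>j. j < J \<Longrightarrow> M j > 0" "\<And>j. j < J \<Longrightarrow> coprime (M j) Q"
    and Q: "Q = (\<Prod>i\<in>{1..<k}. a ! i - a ! 0)"
    and K: "K = 2 * Q * (a ! (k-1) - a ! 0)"
    and zero: "\<And>g. (\<Sum>i<k. c i * g (colour J M Q K (n + a ! i * d))) = 0"
    and j: "j < J"
  shows "M j dvd d"
proof -
  have k0: "0 < k" using k(2) by simp
  have mono: "a ! i < a ! i'" if "i < i'" "i' < k" for i i'
    using sorted that k by (simp add: sorted_wrt_iff_nth_less)
  have mono': "a ! i \<le> a ! i'" if "i \<le> i'" "i' < k" for i i'
    using mono[of i i'] that by (cases "i = i'") auto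
  define W where "W = a ! (k-1) - a ! 0"
  have "a ! 0 < a ! (k-1)" using k(2) by (intro mono) auto
  then have W: "W \<ge> 1" by (simp add: W_def)
  have Qpos: "Q \<ge> 1" 
    unfolding Q
  proof (rule prod_ge_1)
    fix i assume "i \<in> {1..<k}"
    then show "1 \<le> a ! i - a ! 0" using mono[of 0 i] by simp
  qed
  have K2: "K \<ge> 2"
  proof -
    have "2 * (1 * 1) \<le> 2 * (Q * W)" using W Qpos by (intro mult_left_mono mult_mono) auto
    then show ?thesis by (simp add: K W_def)
  qed
  let ?col = "\<lambda>i. colour J M Q K (n + a ! i * d)"
  define z where "z i l = (Q * (n + a ! i * d)) mod M l" for i l
  \<comment> \<open>\<open>zero\<close> is applied to the indicator of a property of colours: the
    positions having it carry total weight 0.\<close>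
  have class_sum: "(\<Sum>i\<in>{i. i < k \<and> P (?col i)}. c i) = 0" for P
  proof -
    have "(\<Sum>i\<in>{i. i < k \<and> P (?col i)}. c i) = (\<Sum>i<k. c i * (if P (?col i) then 1 else 0))"
      by (intro sum.mono_neutral_cong_left) auto
    then show ?thesis using zero[of "\<lambda>x. if P x then 1 else 0"] by simp
  qed
  \<comment> \<open>A single position cannot have total weight 0, as no weight vanishes.\<close>
  have partner: "\<exists>i<k. i \<noteq> i0 \<and> P (?col i)" if "i0 < k" "P (?col i0)" for i0 P
  proof (rule ccontr)
    assume "\<not> ?thesis"
    then have "{i. i < k \<and> P (?col i)} = {i0}" using that by auto
    then show False using class_sum[of P] nonzero that by simp
  qed
  obtain i1 where i1: "i1 < k" "i1 \<noteq> 0" "fst (?col i1) = fst (?col 0)"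
    using partner[of 0 "\<lambda>x. fst x = fst (?col 0)"] k0 by blast
  \<comment> \<open>Modulo \<open>M l\<close>, \<open>(a ! i1 - a ! 0) * d\<close> is congruent to
    the difference \<open>\<delta>\<close> of the two residues, and
    \<open>K * \<bar>\<delta>\<bar> \<le> M l\<close>. Since \<open>i1\<close> is not known in
    advance, \<open>Q\<close> contains every possible factor; the cofactor \<open>q\<close> gives
    \<open>\<sigma> = q * \<delta>\<close>, and \<open>K = 2 * Q * W\<close> pays for
    \<open>q \<le> Q\<close> and for \<open>2 * W\<close>.\<close>
  have small: "\<exists>\<sigma>. M l dvd Q * d - \<sigma> \<and> 2 * W * \<bar>\<sigma>\<bar> \<le> M l" if l: "l < J" for l
  proof -
    define \<delta> where "\<delta> = (n + a ! i1 * d) mod M l - (n + a ! 0 * d) mod M l"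
    define q where "q = (\<Prod>i\<in>{1..<k} - {i1}. a ! i - a ! 0)"
    have Qq: "Q = (a ! i1 - a ! 0) * q" unfolding Q q_def using i1 by (intro prod.remove) auto
    have q: "0 < q" "q \<le> Q"
    proof -
      show "0 < q" unfolding q_def using mono by (intro prod_pos) auto
      moreover have "1 \<le> a ! i1 - a ! 0" using mono[of 0 i1] i1 by simp
      ultimately show "q \<le> Q" unfolding Qq by (simp add: mult_le_cancel_right1)
    qed
    have "(K * ((n + a ! i1 * d) mod M l)) div M l = (K * ((n + a ! 0 * d) mod M l)) div M l"
      using fun_cong[OF i1(3), of l] l by (simp add: colour_def)
    from abs_diff_less_if_div_eq[OF M(1)[OF l] this]
    have "\<bar>K * \<delta>\<bar> < M l" by (simp only: \<delta>_def right_diff_distrib)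
    then have "K * \<bar>\<delta>\<bar> \<le> M l" using K2 by (simp add: abs_mult)
    have "2 * W * \<bar>q * \<delta>\<bar> \<le> 2 * W * (Q * \<bar>\<delta>\<bar>)" using q W by (intro mult_left_mono) (auto simp: abs_mult mult_right_mono)
    also have "\<dots> = K * \<bar>\<delta>\<bar>" by (simp add: K W_def)
    also have "\<dots> \<le> M l" by fact
    finally have 1: "2 * W * \<bar>q * \<delta>\<bar> \<le> M l" .
    have "\<delta> - (a ! i1 - a ! 0) * d = M l * ((n + a ! 0 * d) div M l - (n + a ! i1 * d) div M l)"
      unfolding \<delta>_def by (simp add: minus_mult_div_eq_mod[symmetric] algebra_simps)
    then have "M l dvd \<delta> - (a ! i1 - a ! 0) * d" by simp
    then have "M l dvd (- q) * (\<delta> - (a ! i1 - a ! 0) * d)" by (rule dvd_mult)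
    then have "M l dvd Q * d - q * \<delta>" by (simp add: Qq algebra_simps)
    with 1 show ?thesis by blast
  qed
  obtain \<sigma> where \<sigma>: "\<And>l. l < J \<Longrightarrow> M l dvd Q * d - \<sigma> l" "\<And>l. l < J \<Longrightarrow> 2 * W * \<bar>\<sigma> l\<bar> \<le> M l"
    using small by metis
  have zstep: "z i l = (z 0 l + (a ! i - a ! 0) * \<sigma> l) mod M l" if "l < J" for i l
  proof -
    have "M l dvd (a ! i - a ! 0) * (Q * d - \<sigma> l)" using \<sigma>(1)[OF that] by (rule dvd_mult)
    then have "(Q * (n + a ! i * d)) mod M l = (Q * (n + a ! 0 * d) + (a ! i - a ! 0) * \<sigma> l) mod M l"
      by (simp add: mod_eq_dvd_iff algebra_simps)
    then show ?thesis by (simp add: z_def mod_simps)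
  qed
  have z0: "z 0 l mod M l = z 0 l" for l by (simp add: z_def)
  define cell where "cell i l = (K * z i l) div M l" for i l
  have cell_fst: "fst (snd (?col i)) = fst (snd (?col 0)) \<longleftrightarrow> (\<forall>l<J. cell i l = cell 0 l)" for i
    by (auto simp: colour_def cell_def z_def fun_eq_iff restrict_def)
  define L where "L = {i. i < k \<and> fst (snd (?col i)) = fst (snd (?col 0))}"
  have wrap: "z i' l = z 0 l + (a ! i' - a ! 0) * \<sigma> l \<and> cell i' l = cell 0 l"
    if "i \<in> L" "i' \<le> i" "l < J" for i i' l
  proof -
    have i: "i < k" "cell i l = cell 0 l" using that cell_fst by (auto simp: L_def)
    have ord: "0 \<le> a ! i' - a ! 0" "a ! i' - a ! 0 \<le> a ! i - a ! 0" "a ! i - a ! 0 \<le> W"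
      using mono'[of 0 i'] mono'[of i' i] mono'[of i "k-1"] that i k0 by (auto simp: W_def)
    have eq: "(z 0 l + (a ! i0 - a ! 0) * \<sigma> l) mod M l = z i0 l" for i0
      by (rule zstep[OF that(3), symmetric])
    have "(K * ((z 0 l + (a ! i - a ! 0) * \<sigma> l) mod M l)) div M l = (K * (z 0 l mod M l)) div M l"
      using i(2) by (simp only: eq z0 cell_def)
    from no_wrap[OF M(1)[OF that(3)] K2 \<sigma>(2)[OF that(3)] ord this]
    show ?thesis by (simp only: eq z0 cell_def)
  qed
  \<comment> \<open>By \<open>wrap\<close> the positions sharing the cells of position 0 form an
    initial segment. Its weight is 0, whereas proper nonempty initial segments have nonzero
    weight.\<close>
  have "L = {..<k}"
  proof -
    have fin: "finite L" by (simp add: L_def)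
    have down: "i' \<in> L" if "i \<in> L" "i' \<le> i" for i i'
      using wrap[OF that] that cell_fst by (auto simp: L_def)
    have "L = {..<Suc (Max L)}"
    proof
      show "L \<subseteq> {..<Suc (Max L)}" using fin by (auto simp: less_Suc_eq_le)
      have "0 \<in> L" using k0 by (auto simp: L_def)
      then have "Max L \<in> L" using fin by (intro Max_in) auto
      then show "{..<Suc (Max L)} \<subseteq> L" using down by (auto simp: less_Suc_eq_le)
    qed
    then obtain r where r: "L = {..<r}" "r > 0" by blast
    have "L \<subseteq> {..<k}" by (auto simp: L_def)
    then have "r \<le> k" using r by simp
    moreover have "(\<Sum>i<r. c i) = 0"
      using class_sum[of "\<lambda>x. fst (snd x) = fst (snd (?col 0))"] r by (simp add: L_def[symmetric])
    ultimately have "r = k" using partial[of r] r(2) by linarith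
    then show ?thesis using r by simp
  qed
  then have zlin: "z i l = z 0 l + (a ! i - a ! 0) * \<sigma> l" if "i < k" "l < J" for i l
    using wrap[of i i l] that by simp
  define A where "A = (\<Sum>l<J. (z 0 l)\<^sup>2)"
  define B where "B = (\<Sum>l<J. 2 * z 0 l * \<sigma> l)"
  define C where "C = (\<Sum>l<J. (\<sigma> l)\<^sup>2)"
  have rho: "snd (snd (?col i)) = A + B * (a ! i - a ! 0) + C * (a ! i - a ! 0)\<^sup>2" if "i < k" for i
  proof -
    have "snd (snd (?col i)) = (\<Sum>l<J. (z i l)\<^sup>2)" by (simp add: colour_def z_def)
    also have "\<dots> = (\<Sum>l<J. (z 0 l)\<^sup>2 + 2 * z 0 l * \<sigma> l * (a ! i - a ! 0) + (\<sigma> l)\<^sup>2 * (a ! i - a ! 0)\<^sup>2)"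
    proof (intro sum.cong refl)
      fix l assume "l \<in> {..<J}"
      then have "z i l = z 0 l + (a ! i - a ! 0) * \<sigma> l" using zlin[OF that] by simp
      then show "(z i l)\<^sup>2 = (z 0 l)\<^sup>2 + 2 * z 0 l * \<sigma> l * (a ! i - a ! 0) + (\<sigma> l)\<^sup>2 * (a ! i - a ! 0)\<^sup>2"
        by (simp only: power2_eq_square) (simp add: algebra_simps)
    qed
    finally show ?thesis by (simp add: A_def B_def C_def sum.distrib sum_distrib_right)
  qed
  \<comment> \<open>Otherwise equal values of the quadratic at distinct entries fix their sum
    \<open>a ! i + a ! i'\<close>, the same for all \<open>i\<close>, and the pattern is symmetric.
    As \<open>C\<close> is the sum of the squares of the \<open>\<sigma> l\<close>, all of these
    vanish.\<close>
  have "C = 0"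
  proof (rule ccontr)
    assume C: "C \<noteq> 0"
    have pair: "\<exists>i'<k. i' \<noteq> i \<and> B + C * (a ! i + a ! i' - 2 * a ! 0) = 0" if i: "i < k" for i
    proof -
      obtain i' where i': "i' < k" "i' \<noteq> i" "snd (snd (?col i')) = snd (snd (?col i))"
        using partner[of i "\<lambda>x. snd (snd x) = snd (snd (?col i))"] i by blast
      have "(a ! i' - a ! i) * (B + C * (a ! i + a ! i' - 2 * a ! 0)) = 0"
        using i'(3) rho[OF i] rho[OF i'(1)] by (simp add: power2_eq_square algebra_simps)
      moreover have "a ! i' \<noteq> a ! i" using mono[of i i'] mono[of i' i] i' i by (cases "i < i'") force+
      ultimately show ?thesis using i' by auto
    qed
    obtain i0 where i0: "i0 < k" "B + C * (a ! 0 + a ! i0 - 2 * a ! 0) = 0" using pair[of 0] k0 by blast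
    have "symmetric_pattern a"
    proof (rule symmetric_if_reflections[OF sorted])
      fix i assume "i < length a"
      then obtain i' where i': "i' < k" "i' \<noteq> i" "B + C * (a ! i + a ! i' - 2 * a ! 0) = 0"
        using pair[of i] k(1) by blast
      have "C * ((a ! i + a ! i') - (a ! 0 + a ! i0)) = 0" using i' i0 by (simp add: algebra_simps)
      then show "\<exists>j<length a. j \<noteq> i \<and> a ! i + a ! j = a ! 0 + a ! i0" using C i' k(1) by auto
    qed
    then show False using asym by simp
  qed
  then have "\<sigma> j = 0" using j unfolding C_def by (subst (asm) sum_nonneg_eq_0_iff) auto
  then have "M j dvd Q * d" using \<sigma>(1)[OF j] by simp
  then show ?thesis using M(2)[OF j] by (metis coprime_dvd_mult_right_iff)
qed

text \<open>Numbering the colours and coding the numbers gives one integer-valued function, whose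
  single relation yields the relation for every function of the colour. The colours, and with them
  the bound on \<open>f\<close>, grow exponentially in \<open>J\<close> with a base independent of
  \<open>J\<close>, whereas the period grows like an exponential of the square of
  \<open>J\<close>.\<close>

lemma detecting_function:
  fixes a :: "int list" and c :: "nat \<Rightarrow> int"
  assumes sorted: "sorted_wrt (<) a" and k: "k = length a" "k \<ge> 2"
    and asym: "\<not> symmetric_pattern a"
    and total: "(\<Sum>i<k. c i) = 0"
    and partial: "\<And>r. 0 < r \<Longrightarrow> r < k \<Longrightarrow> (\<Sum>i<r. c i) \<noteq> 0"
    and nonzero: "\<And>i. i < k \<Longrightarrow> c i \<noteq> 0"
  obtains E :: nat where "E \<ge> 2"
    and "\<And>J. J \<ge> 1 \<Longrightarrow> \<exists>(m::nat) f. 4 ^ (J * J) \<le> m \<and>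
          (\<forall>n. 0 \<le> f n \<and> f n \<le> int E ^ J) \<and>
          (\<forall>x y. int m dvd x - y \<longrightarrow> f x = f y) \<and>
          (\<forall>n d. (\<Sum>i<k. c i * f (n + a ! i * d)) = 0 \<longrightarrow> int m dvd d)"
proof -
  define Q where "Q = (\<Prod>i\<in>{1..<k}. a ! i - a ! 0)"
  define q where "q = nat Q"
  have mono: "a ! i < a ! i'" if "i < i'" "i' < k" for i i'
    using sorted that k by (simp add: sorted_wrt_iff_nth_less)
  have Qpos: "Q > 0" unfolding Q_def using mono by (intro prod_pos) auto
  have q: "q > 0" "int q = Q" using Qpos by (auto simp: q_def)
  define K where "K = 2 * Q * (a ! (k-1) - a ! 0)"
  have "a ! 0 < a ! (k-1)" using k(2) by (intro mono) auto
  then have K: "K \<ge> 1" using Qpos by (simp add: K_def int_one_le_iff_zero_less)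
  \<comment> \<open>Base for the number of colours: \<open>(nat K)\<^sup>2\<close> for the two cells
    per modulus, \<open>512 = 2 * 256\<close> from \<open>J + 1 \<le> 2 ^ J\<close> and
    \<open>X ^ 4 = 256 ^ J * 256 ^ q\<close>, and \<open>256 ^ q\<close> for the remaining factor,
    using \<open>J \<ge> 1\<close>.\<close>
  define E1 where "E1 = (nat K)\<^sup>2 * 512 * 256 ^ q"
  define C where "C = (\<Sum>i<k. \<bar>c i\<bar>)"
  have C: "C \<ge> 0" by (simp add: C_def sum_nonneg)
  define A where "A = k * (nat C + 1) ^ k"
  define E where "E = A * E1 ^ (k * k + k)"
  have E1: "E1 \<ge> 1" using K by (simp add: E1_def Suc_le_eq)
  have A: "A \<ge> 2"
  proof -
    have "2 * 1 \<le> k * (nat C + 1) ^ k" using k(2) by (intro mult_le_mono) auto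
    then show ?thesis by (simp add: A_def)
  qed
  show ?thesis
  proof
    have "2 * 1 \<le> A * E1 ^ (k * k + k)" using A E1 by (intro mult_le_mono) auto
    then show "2 \<le> E" by (simp add: E_def)
  next
    fix J :: nat assume J: "J \<ge> 1"
    define X :: nat where "X = 4 ^ (J + q)"
    obtain M where M: "\<And>j. j < J \<Longrightarrow> X \<le> M j" "\<And>j. j < J \<Longrightarrow> M j \<le> X\<^sup>2"
        "\<And>j. j < J \<Longrightarrow> coprime (M j) q"
        "\<And>i j. i < J \<Longrightarrow> j < J \<Longrightarrow> i \<noteq> j \<Longrightarrow> coprime (M i) (M j)"
      using coprime_moduli[OF q(1), of J] unfolding X_def by metis
    have X: "X \<ge> 1" by (simp add: X_def)
    have Mpos: "M j > 0" if "j < J" for j using M(1)[OF that] X by simp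
    define m where "m = (\<Prod>j<J. M j)"
    define col where "col = colour J (\<lambda>j. int (M j)) Q K"
    define Col where "Col = (\<Pi>\<^sub>E j\<in>{..<J}. {0..<K}) \<times> (\<Pi>\<^sub>E j\<in>{..<J}. {0..<K}) \<times> {0..int (J * X ^ 4)}"
    define R where "R = card Col"
    have finCol: "finite Col" unfolding Col_def by (intro finite_cartesian_product finite_PiE) auto
    have cell: "(K * (x mod int (M j))) div int (M j) \<in> {0..<K}" if "j < J" for x j
    proof -
      have "x mod int (M j) < int (M j)" "0 \<le> x mod int (M j)" using Mpos[OF that] by auto
      then have "0 \<le> K * (x mod int (M j))" "K * (x mod int (M j)) < K * int (M j)" using K by auto
      moreover have "0 \<le> K * (x mod int (M j)) mod int (M j)" using Mpos[OF that] by simp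
      ultimately have "K * (x mod int (M j)) div int (M j) * int (M j) < K * int (M j)"
        using div_mult_mod_eq[of "K * (x mod int (M j))" "int (M j)"] by linarith
      then show ?thesis using Mpos[OF that] \<open>0 \<le> K * (x mod int (M j))\<close>
        by (auto simp: pos_imp_zdiv_nonneg_iff)
    qed
    have sq: "(\<Sum>j<J. ((Q * n) mod int (M j))\<^sup>2) \<le> int (J * X ^ 4)" for n
    proof -
      have "(\<Sum>j<J. ((Q * n) mod int (M j))\<^sup>2) \<le> (\<Sum>j<J. int (X ^ 4))"
      proof (rule sum_mono)
        fix j assume "j \<in> {..<J}"
        then have j: "j < J" by simp
        have "(Q * n) mod int (M j) < int (M j)" "0 \<le> (Q * n) mod int (M j)" using Mpos[OF j] by auto
        moreover have "int (M j) \<le> int (X\<^sup>2)" using M(2)[OF j] by linarith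
        ultimately have "0 \<le> (Q * n) mod int (M j)" "(Q * n) mod int (M j) \<le> int (X\<^sup>2)" by linarith+
        then have "((Q * n) mod int (M j))\<^sup>2 \<le> (int (X\<^sup>2))\<^sup>2" by (rule power_mono[rotated])
        also have "\<dots> = int (X ^ 4)" by (simp flip: power_mult)
        finally show "((Q * n) mod int (M j))\<^sup>2 \<le> int (X ^ 4)" .
      qed
      then show ?thesis by simp
    qed
    have colCol: "col n \<in> Col" for n
      using cell sq[of n] by (auto simp: col_def colour_def Col_def intro!: sum_nonneg)
    obtain h where h: "bij_betw h Col {0..<R}"
      using ex_bij_betw_finite_nat[OF finCol] by (auto simp: R_def)
    have k1: "1 \<le> k" using k(2) by simp
    obtain \<phi> where \<phi>: "\<forall>v<R. 0 \<le> \<phi> v \<and> \<phi> v \<le> int k * (C + 1) ^ k * int R ^ (k * k + k)"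
      "\<forall>v g. (\<forall>i<k. v i < R) \<longrightarrow> (\<Sum>i<k. c i * \<phi> (v i)) = 0 \<longrightarrow> (\<Sum>i<k. c i * g (v i)) = 0"
      using colour_code[OF total k1, of R] unfolding C_def by (elim exE conjE)
    have hR: "h (col n) < R" for n using h colCol[of n] by (auto simp: bij_betw_def)
    define f where "f n = \<phi> (h (col n))" for n
    have "R \<le> E1 ^ J"
    proof -
      have "R = nat K ^ J * (nat K ^ J * (J * X ^ 4 + 1))"
        by (simp add: R_def Col_def card_cartesian_product card_PiE nat_add_distrib del: of_nat_mult of_nat_power)
      also have "\<dots> \<le> nat K ^ J * (nat K ^ J * (2 ^ J * X ^ 4))"
      proof (intro mult_le_mono le_refl)
        have "J * X ^ 4 + 1 \<le> (J + 1) * X ^ 4" using X by simp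
        also have "J + 1 \<le> 2 ^ J" using less_exp[of J] by linarith
        finally show "J * X ^ 4 + 1 \<le> 2 ^ J * X ^ 4" by simp
      qed
      also have "X ^ 4 = 256 ^ J * 256 ^ q"
      proof -
        have "X ^ 4 = (4 ^ 4) ^ (J + q)" unfolding X_def by (simp only: power_mult[symmetric] mult.commute)
        then show ?thesis by (simp add: power_add)
      qed
      also have "nat K ^ J * (nat K ^ J * (2 ^ J * (256 ^ J * 256 ^ q))) = ((nat K)\<^sup>2 * 512) ^ J * 256 ^ q"
      proof -
        have "(512::nat) = 2 * 256" by simp
        then show ?thesis by (simp only: power_mult_distrib power2_eq_square)
      qed
      also have "\<dots> \<le> ((nat K)\<^sup>2 * 512) ^ J * (256 ^ q) ^ J"
        using J by (intro mult_le_mono le_refl) (simp add: self_le_power)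
      also have "\<dots> = E1 ^ J" by (simp add: E1_def power_mult_distrib)
      finally show ?thesis .
    qed
    have "int k * (C + 1) ^ k * int R ^ (k * k + k) \<le> int E ^ J"
    proof -
      have "k * (nat C + 1) ^ k * R ^ (k * k + k) \<le> A ^ J * (E1 ^ J) ^ (k * k + k)"
        unfolding A_def[symmetric] using \<open>R \<le> E1 ^ J\<close> A J
        by (intro mult_le_mono power_mono) (auto simp: self_le_power)
      also have "\<dots> = E ^ J" by (simp add: E_def power_mult_distrib flip: power_mult) (simp add: mult.commute)
      finally have "int (k * (nat C + 1) ^ k * R ^ (k * k + k)) \<le> int (E ^ J)" by linarith
      then show ?thesis using C by (simp add: add.commute)
    qed
    then have fE: "0 \<le> f n \<and> f n \<le> int E ^ J" for n using \<phi>(1)[rule_format, OF hR[of n]] by (auto simp: f_def)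
    have "4 ^ (J * J) \<le> m"
    proof -
      have "(4::nat) ^ (J * J) \<le> (4 ^ (J + q)) ^ J" unfolding power_mult[symmetric] by (intro power_increasing) auto
      also have "\<dots> = (\<Prod>j<J. X)" by (simp add: X_def)
      also have "\<dots> \<le> m" unfolding m_def using M(1) by (intro prod_mono) auto
      finally show ?thesis .
    qed
    moreover have "f x = f y" if "int m dvd x - y" for x y
    proof -
      have "int (M j) dvd x - y" if "j < J" for j
      proof -
        have "M j dvd m" unfolding m_def using that by (intro dvd_prodI) auto
        then show ?thesis using \<open>int m dvd x - y\<close> by (meson dvd_trans int_dvd_int_iff)
      qed
      then have "x mod int (M j) = y mod int (M j)" "(Q * x) mod int (M j) = (Q * y) mod int (M j)" if "j < J" for j
        using that by (auto simp: mod_eq_dvd_iff simp flip: right_diff_distrib)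
      then have "col x = col y" by (auto simp: col_def colour_def intro!: restrict_ext sum.cong)
      then show ?thesis by (simp add: f_def)
    qed
    moreover have "int m dvd d" if z: "(\<Sum>i<k. c i * f (n + a ! i * d)) = 0" for n d
    proof -
      \<comment> \<open>The numbering \<open>h\<close> is injective on \<open>Col\<close>, so each
        function of the colour is a function of its number.\<close>
      have "(\<Sum>i<k. c i * g (col (n + a ! i * d))) = 0" for g
      proof -
        have "(\<Sum>i<k. c i * g (inv_into Col h (h (col (n + a ! i * d))))) = 0"
          by (rule \<phi>(2)[rule_format, where v = "\<lambda>i. h (col (n + a ! i * d))" and g = "\<lambda>x. g (inv_into Col h x)"])
             (use hR z in \<open>auto simp: f_def\<close>)
        moreover have "inv_into Col h (h (col n)) = col n" for n
          using h colCol by (auto simp: bij_betw_def intro: inv_into_f_f)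
        ultimately show ?thesis by simp
      qed
      then have zero: "(\<Sum>i<k. c i * g (colour J (\<lambda>j. int (M j)) Q K (n + a ! i * d))) = 0" for g
        by (simp only: col_def)
      have coprimeQ: "coprime (int (M j)) Q" if "j < J" for j
        using M(3)[OF that] q(2) by (metis coprime_int_iff)
      have "int (M j) dvd d" if "j < J" for j
        by (rule colour_rigid[where M = "\<lambda>j. int (M j)", OF sorted k asym total _ _ _ _ Q_def K_def zero that])
          (use partial nonzero Mpos coprimeQ in auto)
      then show ?thesis unfolding m_def by (intro prod_dvd_of_coprime M(4)) auto
    qed
    ultimately show "\<exists>(m::nat) f. 4 ^ (J * J) \<le> m \<and>
          (\<forall>n. 0 \<le> f n \<and> f n \<le> int E ^ J) \<and>
          (\<forall>x y. int m dvd x - y \<longrightarrow> f x = f y) \<and>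
          (\<forall>n d. (\<Sum>i<k. c i * f (n + a ! i * d)) = 0 \<longrightarrow> int m dvd d)"
      using fE by blast
  qed
qed

section \<open>Additive characters and intervals\<close>

definition add_char :: "nat \<Rightarrow> int \<Rightarrow> complex" where
  "add_char p x = cis (2 * pi * of_int x / of_nat p)"

lemma norm_add_char [simp]: "norm (add_char p x) = 1"
  by (simp add: add_char_def)

lemma add_char_0 [simp]: "add_char p 0 = 1"
  by (simp add: add_char_def)

lemma add_char_add: "add_char p (x + y) = add_char p x * add_char p y"
  by (simp add: add_char_def cis_mult algebra_simps add_divide_distrib)

lemma cnj_add_char: "cnj (add_char p x) = add_char p (- x)"
  by (simp add: add_char_def cis_cnj)

lemma add_char_mult_nat: "add_char p (x * int n) = add_char p x ^ n"
  by (simp add: add_char_def Complex.DeMoivre algebra_simps)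

lemma add_char_cong:
  assumes "p > 0" "int p dvd x - y"
  shows "add_char p x = add_char p y"
proof -
  obtain z where "x - y = int p * z" using assms(2) by (elim dvdE)
  then have z: "x = y + int p * z" by simp
  have "2 * pi * real_of_int (int p * z) / real p = 2 * pi * real_of_int z" using assms(1) by simp
  then have "add_char p (int p * z) = cis (2 * pi * real_of_int z)" by (simp only: add_char_def)
  also have "\<dots> = 1" by (rule cis_multiple_2pi) simp
  finally have "add_char p (int p * z) = 1" .
  then show ?thesis unfolding z add_char_add by simp
qed

text \<open>Jordan's inequality: by concavity the sine lies above its chord from \<open>0\<close> to
  \<open>pi / 2\<close>.\<close>

lemma sin_ge_linear:
  assumes "0 \<le> x" "x \<le> pi / 2"
  shows "2 * x / pi \<le> sin x"
proof -
  have "convex_on {0..pi/2} (\<lambda>x. - sin x)"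
    by (rule f''_ge0_imp_convex[where f' = "\<lambda>x. - cos x" and f'' = sin])
       (auto intro!: derivative_eq_intros sin_ge_zero)
  then have "- sin ((1 - 2 * x / pi) *\<^sub>R 0 + (2 * x / pi) *\<^sub>R (pi / 2)) \<le>
      (1 - 2 * x / pi) * (- sin 0) + (2 * x / pi) * (- sin (pi / 2))"
    by (rule convex_onD) (use assms in \<open>auto simp: field_simps\<close>)
  then show ?thesis by simp
qed

text \<open>The norm equals \<open>2 * sin y\<close> with \<open>y = pi * \<xi> / p\<close>, and
  Jordan's inequality applies to \<open>y\<close> or to \<open>pi - y\<close>. Adding both
  reciprocals covers the two cases by one bound.\<close>

lemma norm_one_minus_add_char:
  assumes "0 < \<xi>" "\<xi> < int p"
  shows "1 / norm (1 - add_char p \<xi>) \<le> real p / 4 * (1 / of_int \<xi> + 1 / of_int (int p - \<xi>))"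
    and "add_char p \<xi> \<noteq> 1"
proof -
  have p: "p > 0" using assms by linarith
  define y where "y = pi * of_int \<xi> / of_nat p"
  have y: "0 < y" "y < pi" using assms p by (auto simp: y_def field_simps)
  have "(norm (1 - add_char p \<xi>))\<^sup>2 = (1 - cos (2 * y))\<^sup>2 + (sin (2 * y))\<^sup>2"
    by (simp add: cmod_def add_char_def y_def mult.assoc)
  also have "\<dots> = 2 - 2 * cos (2 * y)"
    using sin_cos_squared_add[of "2 * y"] by (simp add: power2_eq_square algebra_simps)
  also have "\<dots> = (2 * sin y)\<^sup>2" by (simp add: cos_double_sin power2_eq_square)
  finally have sq: "(norm (1 - add_char p \<xi>))\<^sup>2 = (2 * sin y)\<^sup>2" .
  have norm: "norm (1 - add_char p \<xi>) = 2 * sin y"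
    by (rule power2_eq_imp_eq[OF sq norm_ge_zero]) (use sin_gt_zero[OF y] in simp)
  have pos: "0 < norm (1 - add_char p \<xi>)" unfolding norm using y sin_gt_zero[of y] by simp
  then show "add_char p \<xi> \<noteq> 1" by auto
  have pos': "0 < 1 / real_of_int \<xi>" "0 < 1 / real_of_int (int p - \<xi>)" using assms by auto
  show "1 / norm (1 - add_char p \<xi>) \<le> real p / 4 * (1 / of_int \<xi> + 1 / of_int (int p - \<xi>))"
  proof (cases "y \<le> pi / 2")
    case True
    have "2 * y / pi = 2 * of_int \<xi> / p" by (simp add: y_def)
    then have "4 * of_int \<xi> / p \<le> norm (1 - add_char p \<xi>)" using sin_ge_linear[of y] True y norm by simp
    then have "1 / norm (1 - add_char p \<xi>) \<le> 1 / (4 * of_int \<xi> / p)"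
      using assms p by (intro frac_le) auto
    also have "\<dots> = real p / 4 * (1 / of_int \<xi>)" by simp
    also have "\<dots> \<le> real p / 4 * (1 / of_int \<xi> + 1 / of_int (int p - \<xi>))"
      using pos' by (intro mult_left_mono) auto
    finally show ?thesis .
  next
    case False
    have "2 * (pi - y) / pi = 2 * of_int (int p - \<xi>) / p" using p by (simp add: y_def field_simps)
    moreover have "2 * (pi - y) / pi \<le> sin (pi - y)" using False y by (intro sin_ge_linear) auto
    ultimately have "2 * of_int (int p - \<xi>) / p \<le> sin y" by (simp only: sin_pi_minus)
    then have "2 * (2 * of_int (int p - \<xi>) / p) \<le> norm (1 - add_char p \<xi>)" unfolding norm by (rule mult_left_mono) simp
    then have "4 * of_int (int p - \<xi>) / p \<le> norm (1 - add_char p \<xi>)" by simp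
    then have "1 / norm (1 - add_char p \<xi>) \<le> 1 / (4 * of_int (int p - \<xi>) / p)"
      using assms p pos' by (intro frac_le) (auto intro: divide_pos_pos)
    also have "\<dots> = real p / 4 * (1 / of_int (int p - \<xi>))" by simp
    also have "\<dots> \<le> real p / 4 * (1 / of_int \<xi> + 1 / of_int (int p - \<xi>))"
      using pos' by (intro mult_left_mono) auto
    finally show ?thesis .
  qed
qed

lemma add_char_eq_1_iff:
  assumes "p > 0"
  shows "add_char p x = 1 \<longleftrightarrow> int p dvd x"
proof -
  have eq: "add_char p x = add_char p (x mod int p)" using assms
    by (intro add_char_cong) (auto simp: minus_mod_eq_mult_div)
  show ?thesis
  proof (cases "x mod int p = 0")
    case True
    then show ?thesis unfolding eq by auto
  next
    case False
    moreover have "0 \<le> x mod int p" "x mod int p < int p" using assms by simp_all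
    ultimately have "0 < x mod int p" by linarith
    from norm_one_minus_add_char(2)[OF this \<open>x mod int p < int p\<close>] False show ?thesis
      by (simp only: eq dvd_eq_mod_eq_0)
  qed
qed

lemma sum_add_char:
  assumes "p > 0"
  shows "(\<Sum>t<p. add_char p (x * int t)) = (if int p dvd x then of_nat p else 0)"
proof (cases "int p dvd x")
  case True
  then have "add_char p x = 1" using assms add_char_eq_1_iff by blast
  then show ?thesis using True by (simp add: add_char_mult_nat)
next
  case False
  then have "add_char p x \<noteq> 1" using assms add_char_eq_1_iff by blast
  moreover have "add_char p x ^ p = 1"
    using assms by (simp add: add_char_mult_nat[symmetric] add_char_eq_1_iff)
  ultimately show ?thesis using False by (simp add: add_char_mult_nat geometric_sum)
qed

lemma harmonic_sum_le:
  "n \<ge> 1 \<Longrightarrow> (\<Sum>\<xi>=1..n. 1 / real \<xi>) \<le> 1 + ln (real n)"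
proof (induction n rule: dec_induct)
  case (step n)
  have "ln (real n / real (Suc n)) \<le> real n / real (Suc n) - 1" using step by (intro ln_le_minus_one) auto
  also have "real n / real (Suc n) - 1 = - (1 / real (Suc n))" by (simp add: field_simps)
  also have "ln (real n / real (Suc n)) = ln (real n) - ln (real (Suc n))" using step by (simp add: ln_div)
  finally have "1 / real (Suc n) \<le> ln (real (Suc n)) - ln (real n)" by simp
  then show ?case using step by simp
qed simp

definition interval_coeff :: "nat \<Rightarrow> nat \<Rightarrow> int \<Rightarrow> complex" where
  "interval_coeff p L \<xi> = (\<Sum>v<L. add_char p (- \<xi> * int v)) / of_nat p"

text \<open>Fourier inversion modulo \<open>p\<close> for the residues \<open>0, ..., L - 1\<close>;
  the zero frequency contributes \<open>L / p\<close> and is moved to the left.\<close>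

lemma interval_fourier:
  assumes p: "p > 0" and L: "L \<le> p"
  shows "(if u mod int p < int L then 1 else 0) - of_nat L / of_nat p =
     (\<Sum>\<xi>=1..<p. interval_coeff p L (int \<xi>) * add_char p (int \<xi> * u))"
proof -
  have term_eq: "interval_coeff p L (int \<xi>) * add_char p (int \<xi> * u) =
      (\<Sum>v<L. add_char p ((u - int v) * int \<xi>)) / of_nat p" for \<xi>
  proof -
    have "(u - int v) * int \<xi> = - int \<xi> * int v + int \<xi> * u" for v by (simp add: algebra_simps)
    then show ?thesis by (simp only: interval_coeff_def add_char_add times_divide_eq_left sum_distrib_right)
  qed
  have "(\<Sum>\<xi><p. interval_coeff p L (int \<xi>) * add_char p (int \<xi> * u)) =
      (\<Sum>\<xi><p. \<Sum>v<L. add_char p ((u - int v) * int \<xi>)) / of_nat p"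
    by (simp only: term_eq sum_divide_distrib)
  also have "(\<Sum>\<xi><p. \<Sum>v<L. add_char p ((u - int v) * int \<xi>)) =
      (\<Sum>v<L. if int p dvd u - int v then of_nat p else 0)"
    by (subst sum.swap) (simp add: sum_add_char[OF p])
  also have "\<dots> = (\<Sum>v<L. if v = nat (u mod int p) then of_nat p else 0)"
  proof (rule sum.cong)
    fix v assume "v \<in> {..<L}"
    then have "int v mod int p = int v" using L by simp
    then have "int p dvd u - int v \<longleftrightarrow> v = nat (u mod int p)" using p by (auto simp: mod_eq_dvd_iff[symmetric])
    then show "(if int p dvd u - int v then of_nat p else 0) = (if v = nat (u mod int p) then of_nat p else (0::complex))"
      by simp
  qed simp
  also have "\<dots> / of_nat p = (if u mod int p < int L then 1 else 0)"
    using p by (auto simp: nat_less_iff)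
  finally have "(\<Sum>\<xi><p. interval_coeff p L (int \<xi>) * add_char p (int \<xi> * u)) = (if u mod int p < int L then 1 else 0)" .
  moreover have "{..<p} = insert 0 {1..<p}" using p by auto
  ultimately show ?thesis by (simp add: interval_coeff_def algebra_simps)
qed

text \<open>The coefficients are geometric sums, and the bound for their denominators sums to a
  harmonic series. The resulting logarithm is harmless against the power of \<open>p\<close> saved
  by Weyl differencing.\<close>

lemma sum_norm_interval_coeff:
  assumes p: "p \<ge> 2"
  shows "(\<Sum>\<xi>=1..<p. norm (interval_coeff p L (int \<xi>))) \<le> 1 + ln p"
proof -
  have bound: "norm (interval_coeff p L (int \<xi>)) \<le> 1/2 * (1 / real \<xi> + 1 / real (p - \<xi>))"
    if "\<xi> \<in> {1..<p}" for \<xi>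
  proof -
    have ne: "add_char p (- int \<xi>) \<noteq> 1" using that
      by (subst add_char_eq_1_iff) (auto dest: zdvd_imp_le)
    have n1: "norm (1 - add_char p (- int \<xi>)) = norm (1 - add_char p (int \<xi>))"
      by (metis cnj_add_char complex_cnj_diff complex_cnj_one complex_mod_cnj)
    have "interval_coeff p L (int \<xi>) = (1 - add_char p (- int \<xi>) ^ L) / (1 - add_char p (- int \<xi>)) / of_nat p"
      using ne unfolding interval_coeff_def add_char_mult_nat by (simp only: sum_gp_strict if_False)
    also have "norm \<dots> = norm (1 - add_char p (- int \<xi>) ^ L) * (1 / norm (1 - add_char p (int \<xi>))) / real p"
      by (simp add: norm_divide norm_mult n1)
    also have "\<dots> \<le> 2 * (real p / 4 * (1 / of_int (int \<xi>) + 1 / of_int (int p - int \<xi>))) / real p"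
    proof (intro divide_right_mono mult_mono)
      have "norm (1 - add_char p (- int \<xi>) ^ L) \<le> norm (1::complex) + norm (add_char p (- int \<xi>) ^ L)" by (rule norm_triangle_ineq4)
      then show "norm (1 - add_char p (- int \<xi>) ^ L) \<le> 2" by (simp add: norm_power)
      show "1 / norm (1 - add_char p (int \<xi>)) \<le> real p / 4 * (1 / of_int (int \<xi>) + 1 / of_int (int p - int \<xi>))"
        using that by (intro norm_one_minus_add_char) auto
    qed auto
    also have "\<dots> = 1/2 * (1 / of_int (int \<xi>) + 1 / of_int (int p - int \<xi>))" using p by simp
    finally show ?thesis using that by (simp only: of_int_diff of_int_of_nat_eq) (simp add: of_nat_diff)
  qed
  have "(\<Sum>\<xi>=1..<p. norm (interval_coeff p L (int \<xi>))) \<le> (\<Sum>\<xi>=1..<p. 1/2 * (1 / real \<xi> + 1 / real (p - \<xi>)))"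
    by (intro sum_mono bound)
  also have "\<dots> = 1/2 * ((\<Sum>\<xi>=1..<p. 1 / real \<xi>) + (\<Sum>\<xi>=1..<p. 1 / real (p - \<xi>)))"
    by (simp only: sum_distrib_left sum.distrib[symmetric])
  also have "(\<Sum>\<xi>=1..<p. 1 / real (p - \<xi>)) = (\<Sum>\<xi>=1..<p. 1 / real \<xi>)"
    by (rule sum.reindex_bij_witness[of _ "\<lambda>\<xi>. p - \<xi>" "\<lambda>\<xi>. p - \<xi>"]) auto
  also have "1/2 * ((\<Sum>\<xi>=1..<p. 1 / real \<xi>) + (\<Sum>\<xi>=1..<p. 1 / real \<xi>)) \<le> (\<Sum>\<xi>=1..p. 1 / real \<xi>)"
  proof -
    have "(\<Sum>\<xi>=1..<p. 1 / real \<xi>) \<le> (\<Sum>\<xi>=1..p. 1 / real \<xi>)" by (rule sum_mono2) auto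
    then show ?thesis by simp
  qed
  also have "\<dots> \<le> 1 + ln (real p)" using p by (intro harmonic_sum_le) auto
  finally show ?thesis .
qed

section \<open>Weyl differencing\<close>

text \<open>That is, the iterated difference of \<open>P\<close> with steps \<open>h\<^sub>1, \<dots>, h\<^sub>s\<close> equals the constant
  \<open>\<kappa> h\<^sub>1 \<cdots> h\<^sub>s\<close>.\<close>

primrec const_diff :: "nat \<Rightarrow> int \<Rightarrow> (int \<Rightarrow> int) \<Rightarrow> bool" where
  "const_diff 0 \<kappa> P \<longleftrightarrow> (\<forall>x. P x = \<kappa>)"
| "const_diff (Suc s) \<kappa> P \<longleftrightarrow> (\<forall>h. const_diff s (\<kappa> * h) (\<lambda>x. P (x + h) - P x))"

lemma const_diff_shift: "const_diff s \<kappa> P \<Longrightarrow> const_diff s \<kappa> (\<lambda>x. P (x + c))"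
proof (induction s arbitrary: \<kappa> P)
  case (Suc s)
  have "const_diff s (\<kappa> * h) (\<lambda>x. P (x + c + h) - P (x + c))" for h
    using Suc.IH[of "\<kappa> * h" "\<lambda>x. P (x + h) - P x"] Suc.prems by simp
  then show ?case by (simp add: add_ac)
qed simp

lemma const_diff_add:
  "const_diff s \<kappa> P \<Longrightarrow> const_diff s \<mu> R \<Longrightarrow> const_diff s (\<kappa> + \<mu>) (\<lambda>x. P x + R x)"
proof (induction s arbitrary: \<kappa> \<mu> P R)
  case (Suc s)
  have "const_diff s (\<kappa> * h + \<mu> * h) (\<lambda>x. (P (x + h) - P x) + (R (x + h) - R x))" for h
    using Suc.IH[of "\<kappa> * h" "\<lambda>x. P (x + h) - P x" "\<mu> * h" "\<lambda>x. R (x + h) - R x"] Suc.prems by simp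
  then show ?case by (simp add: algebra_simps)
qed simp

lemma const_diff_scale: "const_diff s \<kappa> P \<Longrightarrow> const_diff s (r * \<kappa>) (\<lambda>x. r * P x)"
proof (induction s arbitrary: \<kappa> P)
  case (Suc s)
  have "const_diff s (r * (\<kappa> * h)) (\<lambda>x. r * (P (x + h) - P x))" for h
    using Suc.IH[of "\<kappa> * h" "\<lambda>x. P (x + h) - P x"] Suc.prems by simp
  then show ?case by (simp add: algebra_simps)
qed simp

lemma const_diff_sum:
  assumes "\<And>i. i \<in> I \<Longrightarrow> const_diff s (\<kappa> i) (P i)"
  shows "const_diff s (\<Sum>i\<in>I. \<kappa> i) (\<lambda>x. \<Sum>i\<in>I. P i x)"
proof -
  have zero: "const_diff s 0 (\<lambda>x. 0)" for s by (induction s) simp_all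
  show ?thesis
  proof (cases "finite I")
    case True
    then show ?thesis using assms by induction (auto simp: zero intro!: const_diff_add)
  qed (simp add: zero)
qed

text \<open>By the binomial theorem \<open>(x + h) ^ j - x ^ j\<close> is a combination of powers
  below \<open>j\<close>. Only \<open>x ^ s\<close> can contribute after \<open>s\<close> further
  differences, and its coefficient \<open>Suc s * h\<close> for \<open>j = Suc s\<close> builds up
  the factorial.\<close>

lemma const_diff_power:
  "j \<le> s \<Longrightarrow> const_diff s (if j = s then fact s else 0) (\<lambda>x. x ^ j)"
proof (induction s arbitrary: j)
  case (Suc s)
  have "const_diff s ((if j = Suc s then fact (Suc s) else 0) * h) (\<lambda>x. (x + h) ^ j - x ^ j)" for h :: int
  proof -
    have "const_diff s (\<Sum>i<j. (int (j choose i) * h ^ (j - i)) * (if i = s then fact s else 0))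
        (\<lambda>x. \<Sum>i<j. (int (j choose i) * h ^ (j - i)) * x ^ i)"
      using Suc.prems by (intro const_diff_sum const_diff_scale Suc.IH) auto
    moreover have "(\<Sum>i<j. (int (j choose i) * h ^ (j - i)) * x ^ i) = (x + h) ^ j - x ^ j" for x
    proof -
      have "(x + h) ^ j = (\<Sum>i\<le>j. of_nat (j choose i) * x ^ i * h ^ (j - i))" by (rule binomial_ring)
      also have "\<dots> = (\<Sum>i<j. of_nat (j choose i) * x ^ i * h ^ (j - i)) + x ^ j"
        by (simp add: lessThan_Suc_atMost[symmetric])
      finally show ?thesis by (simp add: mult_ac)
    qed
    moreover have "(\<Sum>i<j. (int (j choose i) * h ^ (j - i)) * (if i = s then fact s else 0)) =
        (if j = Suc s then fact (Suc s) else 0) * h"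
    proof -
      have "(\<Sum>i<j. (int (j choose i) * h ^ (j - i)) * (if i = s then fact s else 0)) =
          (\<Sum>i<j. if i = s then (int (j choose i) * h ^ (j - i)) * fact s else 0)"
        by (intro sum.cong) auto
      also have "\<dots> = (if s < j then int (j choose s) * h ^ (j - s) * fact s else 0)" by simp
      also have "\<dots> = (if j = Suc s then fact (Suc s) else 0) * h"
      proof (cases "s < j")
        case True
        then have "j = Suc s" using Suc.prems by simp
        then show ?thesis by (simp add: algebra_simps)
      qed auto
      finally show ?thesis .
    qed
    ultimately show ?thesis by (simp only:)
  qed
  then show ?case by simp
qed simp

section \<open>Sums over tuples of steps and over residue classes\<close>

definition tuples :: "nat \<Rightarrow> nat \<Rightarrow> int list set" where
  "tuples N s = {hs. set hs \<subseteq> {0..<int N} \<and> length hs = s}"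

lemma finite_tuples [simp]: "finite (tuples N s)"
  unfolding tuples_def by (rule finite_lists_length_eq) simp

lemma card_tuples: "card (tuples N s) = N ^ s"
  unfolding tuples_def by (subst card_lists_length_eq) simp_all

lemma tuples_0: "tuples N 0 = {[]}"
  by (auto simp: tuples_def)

lemma sum_tuples_Suc:
  "(\<Sum>hs\<in>tuples N (Suc s). F hs) = (\<Sum>t\<in>tuples N s. \<Sum>h\<in>{0..<int N}. F (h # t))"
proof -
  have "(\<Sum>t\<in>tuples N s. \<Sum>h\<in>{0..<int N}. F (h # t)) = (\<Sum>(t, h)\<in>tuples N s \<times> {0..<int N}. F (h # t))"
    by (rule sum.cartesian_product)
  also have "\<dots> = (\<Sum>hs\<in>tuples N (Suc s). F hs)"
    by (rule sum.reindex_bij_witness[of _ "\<lambda>hs. (tl hs, hd hs)" "\<lambda>(t, h). h # t"])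
       (auto simp: tuples_def length_Suc_conv)
  finally show ?thesis by simp
qed

text \<open>Functions of period \<open>m\<close> are constant in \<open>t\<close>, so that
  cancellation can be sought in the inner sum over \<open>t < p\<close>.\<close>

lemma sum_int_split:
  fixes m p :: nat
  assumes "m > 0"
  shows "(\<Sum>h\<in>{0..<int (m * p)}. F h) = (\<Sum>r<m. \<Sum>t<p. F (int r + int m * int t))"
proof -
  have "(\<Sum>r<m. \<Sum>t<p. F (int r + int m * int t)) = (\<Sum>(r, t)\<in>{..<m} \<times> {..<p}. F (int r + int m * int t))"
    by (rule sum.cartesian_product)
  also have "\<dots> = (\<Sum>h\<in>{0..<int (m * p)}. F h)"
  proof (rule sum.reindex_bij_witness[of _ "\<lambda>h. (nat h mod m, nat h div m)" "\<lambda>(r, t). int r + int m * int t"])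
    fix x assume "x \<in> {..<m} \<times> {..<p}"
    then obtain r t where x: "x = (r, t)" "r < m" "t < p" by auto
    have "r + m * t < m * p"
    proof -
      have "r + m * t < m * (t + 1)" using x by simp
      also have "\<dots> \<le> m * p" using x by (intro mult_le_mono) auto
      finally show ?thesis .
    qed
    then have "int (r + m * t) < int (m * p)" by (simp only: of_nat_less_iff)
    then show "(case x of (r, t) \<Rightarrow> int r + int m * int t) \<in> {0..<int (m * p)}" using x by simp
    show "(nat (case x of (r, t) \<Rightarrow> int r + int m * int t) mod m, nat (case x of (r, t) \<Rightarrow> int r + int m * int t) div m) = x"
      using x by (simp add: nat_add_distrib nat_mult_distrib)
  next
    fix h assume h: "h \<in> {0..<int (m * p)}"
    then have "nat h < p * m" by (auto simp: nat_less_iff mult.commute)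
    then show "(nat h mod m, nat h div m) \<in> {..<m} \<times> {..<p}" using assms by (auto simp: less_mult_imp_div_less)
    have "int (nat h mod m + m * (nat h div m)) = h" using h by simp
    then show "(case (nat h mod m, nat h div m) of (r, t) \<Rightarrow> int r + int m * int t) = h"
      by (simp only: prod.case of_nat_add of_nat_mult)
  qed auto
  finally show ?thesis by simp
qed

text \<open>This counts the degenerate pairs of the Cauchy--Schwarz step and, with \<open>m\<close>
  and \<open>p\<close> exchanged, the multiples of \<open>m\<close> among the differences of
  patterns.\<close>

lemma card_pairs_cong:
  fixes m p :: nat
  assumes "m > 0" "p > 0"
  shows "card {h\<in>{0..<int (m * p)}. int p dvd h - h'} = m"
proof -
  have "card {h\<in>{0..<int (m * p)}. int p dvd h - h'} = (\<Sum>h\<in>{0..<int (p * m)}. if int p dvd h - h' then 1 else 0)"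
    by (subst sum.inter_filter[symmetric]) (simp_all add: mult.commute)
  also have "\<dots> = (\<Sum>r<p. \<Sum>t<m. if int p dvd int r + int p * int t - h' then 1 else 0)"
    by (rule sum_int_split) (use assms in auto)
  also have "\<dots> = (\<Sum>r<p. if r = nat (h' mod int p) then m else 0)"
  proof (rule sum.cong)
    fix r assume r: "r \<in> {..<p}"
    have "int p dvd int r + int p * int t - h' \<longleftrightarrow> r = nat (h' mod int p)" for t
    proof -
      have "int p dvd int r + int p * int t - h' \<longleftrightarrow> int p dvd int r - h'"
        by (metis add_diff_eq add.commute dvd_add_right_iff dvd_triv_left diff_add_eq)
      also have "\<dots> \<longleftrightarrow> int r = h' mod int p" using r by (auto simp: mod_eq_dvd_iff[symmetric])
      also have "\<dots> \<longleftrightarrow> r = nat (h' mod int p)" using assms by auto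
      finally show ?thesis .
    qed
    then show "(\<Sum>t<m. if int p dvd int r + int p * int t - h' then 1 else 0) = (if r = nat (h' mod int p) then m else 0)"
      by simp
  qed simp
  also have "\<dots> = m" using assms by (simp add: nat_less_iff)
  finally show ?thesis .
qed

text \<open>On each class modulo \<open>m\<close>, \<open>\<psi>\<close> is constant and
  \<open>P\<close> is affine in \<open>t\<close> with slope \<open>- (\<kappa> * m)\<close>, prime
  to \<open>p\<close>. What remains is a complete character sum, which vanishes.\<close>

lemma box_sum_base:
  assumes p: "prime p" and m: "m > 0" "\<not> p dvd m"
    and P: "const_diff (Suc 0) \<kappa> P" "\<not> int p dvd \<kappa>"
    and \<psi>: "\<And>u v. int m dvd u - v \<Longrightarrow> \<psi> u = \<psi> v"
  shows "(\<Sum>h\<in>{0..<int (m * p)}. add_char p (P (x - h)) * \<psi> (x - h)) = 0"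
proof -
  have p0: "p > 0" using p by (rule prime_gt_0_nat)
  have nd: "\<not> int p dvd - (\<kappa> * int m)"
    using P(2) m(2) p by (simp add: prime_dvd_mult_iff)
  have "(\<Sum>t<p. add_char p (P (x - (int r + int m * int t))) * \<psi> (x - (int r + int m * int t))) = 0" for r
  proof -
    have "P (x - (int r + int m * int t)) = P (x - int r) + - (\<kappa> * int m) * int t" for t
    proof -
      have "P (y + h) - P y = \<kappa> * h" for y h using P(1) by simp
      from this[of "x - int r" "- (int m * int t)"] show ?thesis by (simp add: algebra_simps)
    qed
    moreover have "\<psi> (x - (int r + int m * int t)) = \<psi> (x - int r)" for t by (rule \<psi>) simp
    ultimately have "(\<Sum>t<p. add_char p (P (x - (int r + int m * int t))) * \<psi> (x - (int r + int m * int t)))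
        = add_char p (P (x - int r)) * \<psi> (x - int r) * (\<Sum>t<p. add_char p (- (\<kappa> * int m) * int t))"
      by (simp only: add_char_add sum_distrib_left mult_ac)
    also have "\<dots> = 0" using nd by (simp only: sum_add_char[OF p0] if_False mult_zero_right)
    finally show ?thesis .
  qed
  then show ?thesis by (simp only: sum_int_split[OF m(1)] sum.neutral_const)
qed

text \<open>The square is expanded into pairs before absolute values are taken, so that for each
  pair \<open>h, h'\<close> a sum over \<open>t\<close> remains in which cancellation is still
  available.\<close>

lemma sum_norm_square_le:
  fixes \<Phi> :: "'a \<Rightarrow> 'b \<Rightarrow> complex"
  shows "(\<Sum>t\<in>T. (norm (\<Sum>h\<in>H. \<Phi> h t))\<^sup>2) \<le> (\<Sum>h'\<in>H. \<Sum>h\<in>H. norm (\<Sum>t\<in>T. \<Phi> h t * cnj (\<Phi> h' t)))"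
proof -
  have "complex_of_real (\<Sum>t\<in>T. (norm (\<Sum>h\<in>H. \<Phi> h t))\<^sup>2) = (\<Sum>t\<in>T. (\<Sum>h\<in>H. \<Phi> h t) * cnj (\<Sum>h\<in>H. \<Phi> h t))"
    by (simp add: complex_norm_square flip: of_real_power)
  also have "\<dots> = (\<Sum>t\<in>T. \<Sum>h'\<in>H. \<Sum>h\<in>H. \<Phi> h t * cnj (\<Phi> h' t))"
    by (simp add: sum_product) (subst sum.swap, rule refl)
  also have "\<dots> = (\<Sum>h'\<in>H. \<Sum>h\<in>H. \<Sum>t\<in>T. \<Phi> h t * cnj (\<Phi> h' t))"
    by (subst sum.swap) (intro sum.cong refl sum.swap)
  finally have eq: "complex_of_real (\<Sum>t\<in>T. (norm (\<Sum>h\<in>H. \<Phi> h t))\<^sup>2) = \<dots>" .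
  have "(\<Sum>t\<in>T. (norm (\<Sum>h\<in>H. \<Phi> h t))\<^sup>2) = norm (complex_of_real (\<Sum>t\<in>T. (norm (\<Sum>h\<in>H. \<Phi> h t))\<^sup>2))"
    by (simp only: norm_of_real) (simp add: sum_nonneg)
  also have "\<dots> \<le> (\<Sum>h'\<in>H. \<Sum>h\<in>H. norm (\<Sum>t\<in>T. \<Phi> h t * cnj (\<Phi> h' t)))"
    unfolding eq by (intro order_trans[OF norm_sum] sum_mono order_refl)
  finally show ?thesis .
qed

text \<open>Weyl differencing: one application of the Cauchy--Schwarz inequality removes the factor that
  does not depend on the first variable.\<close>

lemma box_sum_bound:
  assumes p: "prime p" and m: "m > 0" "\<not> p dvd m"
    and P: "const_diff (Suc s) \<kappa> P" "\<not> int p dvd \<kappa>"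
    and \<psi>: "\<And>u v. int m dvd u - v \<Longrightarrow> \<psi> u = \<psi> v" "\<And>u. norm (\<psi> u) \<le> 1"
    and B: "\<And>i hs. i < Suc s \<Longrightarrow> norm (B i hs) \<le> 1"
      "\<And>i hs y. i < Suc s \<Longrightarrow> B i (hs[i := y]) = B i hs"
  shows "norm (\<Sum>hs\<in>tuples (m * p) (Suc s).
      add_char p (P (x - sum_list hs)) * \<psi> (x - sum_list hs) * (\<Prod>i<Suc s. B i hs))
    \<le> real (Suc s) * real p powr (-1 / 2 ^ s) * real (m * p) ^ Suc s"
  using P \<psi> B
proof (induction s arbitrary: \<kappa> P \<psi> B)
  case 0
  define b0 where "b0 = B 0 [0]"
  have "B 0 [h] = b0" for h unfolding b0_def using "0.prems"(6)[of 0 "[0]" h] by simp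
  then have "(\<Sum>hs\<in>tuples (m * p) (Suc 0). add_char p (P (x - sum_list hs)) * \<psi> (x - sum_list hs) * (\<Prod>i<Suc 0. B i hs))
     = (\<Sum>h\<in>{0..<int (m * p)}. add_char p (P (x - h)) * \<psi> (x - h)) * b0"
    by (simp only: sum_tuples_Suc tuples_0) (simp add: sum_distrib_right)
  also have "(\<Sum>h\<in>{0..<int (m * p)}. add_char p (P (x - h)) * \<psi> (x - h)) = 0"
    by (rule box_sum_base[OF p m "0.prems"(1,2)]) (rule "0.prems"(3))
  finally show ?case by simp
next
  case (Suc s)
  have p0: "p > 0" using p by (rule prime_gt_0_nat)
  define N where "N = m * p"
  have N: "N > 0" using m p0 by (simp add: N_def)
  define T where "T = tuples N (Suc s)"
  define H where "H = {0..<int N}"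
  define \<Phi> where "\<Phi> h t = add_char p (P (x - h - sum_list t)) * \<psi> (x - h - sum_list t) * (\<Prod>i<Suc s. B (Suc i) (h # t))" for h t
  define b where "b = real (Suc s) * real p powr (-1 / 2 ^ s)"
  have b: "b \<ge> 0" by (simp add: b_def)
  define S where "S = norm (\<Sum>hs\<in>tuples (m * p) (Suc (Suc s)).
      add_char p (P (x - sum_list hs)) * \<psi> (x - sum_list hs) * (\<Prod>i<Suc (Suc s). B i hs))"
  have "S \<le> (\<Sum>t\<in>T. norm (\<Sum>h\<in>H. \<Phi> h t))"
  proof -
    \<comment> \<open>The factor of index 0 ignores the first step, so it depends on the tail alone
      and can be taken out of the sum over \<open>h\<close>.\<close>
    define B0 where "B0 t = B 0 (0 # t)" for t
    have "B 0 (h # t) = B0 t" for h t unfolding B0_def using Suc.prems(6)[of 0 "0 # t" h] by simp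
    then have "S = norm (\<Sum>t\<in>T. (\<Sum>h\<in>H. \<Phi> h t) * B0 t)"
      unfolding S_def sum_tuples_Suc[of _ _ "Suc s"] N_def[symmetric] T_def[symmetric] H_def[symmetric] prod.lessThan_Suc_shift[of _ "Suc s"] \<Phi>_def
      by (simp add: sum_distrib_right sum_distrib_left mult_ac diff_diff_eq del: prod.lessThan_Suc)
    also have "\<dots> \<le> (\<Sum>t\<in>T. norm ((\<Sum>h\<in>H. \<Phi> h t) * B0 t))" by (rule norm_sum)
    also have "\<dots> \<le> (\<Sum>t\<in>T. norm (\<Sum>h\<in>H. \<Phi> h t))"
      using Suc.prems(5)[of 0] by (intro sum_mono) (simp add: B0_def norm_mult mult_left_le)
    finally show ?thesis .
  qed
  moreover have "0 \<le> S" by (simp add: S_def)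
  ultimately have "S\<^sup>2 \<le> (\<Sum>t\<in>T. norm (\<Sum>h\<in>H. \<Phi> h t))\<^sup>2" by (intro power_mono)
  also have "\<dots> \<le> (\<Sum>t\<in>T. (norm (\<Sum>h\<in>H. \<Phi> h t))\<^sup>2) * card T"
    by (rule sum_squared_le_sum_of_squares)
  also have "\<dots> \<le> (\<Sum>h'\<in>H. \<Sum>h\<in>H. norm (\<Sum>t\<in>T. \<Phi> h t * cnj (\<Phi> h' t))) * card T"
    by (intro mult_right_mono sum_norm_square_le) simp
  \<comment> \<open>For pairs congruent modulo \<open>p\<close> the differenced coefficient
    \<open>\<kappa> * (h' - h)\<close> is divisible by \<open>p\<close>; they are a proportion
    \<open>1 / p\<close> and are bounded trivially. The induction hypothesis handles the
    others.\<close>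
  also have "(\<Sum>h'\<in>H. \<Sum>h\<in>H. norm (\<Sum>t\<in>T. \<Phi> h t * cnj (\<Phi> h' t))) \<le>
     (\<Sum>h'\<in>H. \<Sum>h\<in>H. (if int p dvd h - h' then real N ^ Suc s else 0) + b * real N ^ Suc s)"
  proof (intro sum_mono)
    fix h h' assume "h \<in> H" "h' \<in> H"
    show "norm (\<Sum>t\<in>T. \<Phi> h t * cnj (\<Phi> h' t)) \<le> (if int p dvd h - h' then real N ^ Suc s else 0) + b * real N ^ Suc s"
    proof (cases "int p dvd h - h'")
      case True
      have "norm (\<Phi> h t) \<le> 1" for h t
        unfolding \<Phi>_def norm_mult prod_norm[symmetric]
        using Suc.prems(4,5) by (auto intro!: mult_le_one prod_le_1 prod_nonneg simp del: prod.lessThan_Suc)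
      then have "norm (\<Sum>t\<in>T. \<Phi> h t * cnj (\<Phi> h' t)) \<le> (\<Sum>t\<in>T. 1)"
        by (intro order_trans[OF norm_sum] sum_mono) (auto simp: norm_mult intro!: mult_le_one)
      also have "\<dots> = real N ^ Suc s" by (simp add: T_def card_tuples)
      also have "\<dots> \<le> real N ^ Suc s + b * real N ^ Suc s" using b by simp
      finally show ?thesis using True by simp
    next
      case False
      define P' where "P' z = P (z - h) - P (z - h')" for z
      define \<psi>' where "\<psi>' z = \<psi> (z - h) * cnj (\<psi> (z - h'))" for z
      define B' where "B' i t = B (Suc i) (h # t) * cnj (B (Suc i) (h' # t))" for i t
      have "\<Phi> h t * cnj (\<Phi> h' t) = add_char p (P' (x - sum_list t)) * \<psi>' (x - sum_list t) * (\<Prod>i<Suc s. B' i t)" for t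
      proof -
        have "x - h - sum_list t = x - sum_list t - h" "x - h' - sum_list t = x - sum_list t - h'" by simp_all
        then show ?thesis
          by (simp only: \<Phi>_def P'_def \<psi>'_def B'_def prod.distrib complex_cnj_mult cnj_prod cnj_add_char diff_conv_add_uminus add_char_add mult_ac)
      qed
      then have "norm (\<Sum>t\<in>T. \<Phi> h t * cnj (\<Phi> h' t)) = norm (\<Sum>t\<in>tuples (m * p) (Suc s).
          add_char p (P' (x - sum_list t)) * \<psi>' (x - sum_list t) * (\<Prod>i<Suc s. B' i t))"
        by (simp only: T_def N_def)
      also have "\<dots> \<le> real (Suc s) * real p powr (-1 / 2 ^ s) * real (m * p) ^ Suc s"
      proof (rule Suc.IH)
        have "const_diff (Suc s) (\<kappa> * (h' - h)) (\<lambda>x. P (x + (h' - h)) - P x)" using Suc.prems(1) by (subst (asm) const_diff.simps(2)) blast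
        from const_diff_shift[OF this, of "- h'"] show "const_diff (Suc s) (\<kappa> * (h' - h)) P'"
          by (simp add: P'_def[abs_def] algebra_simps del: const_diff.simps)
        have "\<not> int p dvd h' - h" using False by (simp add: dvd_diff_commute)
        then show "\<not> int p dvd \<kappa> * (h' - h)" using Suc.prems(2) p by (simp add: prime_dvd_mult_iff)
        show "\<psi>' u = \<psi>' v" if "int m dvd u - v" for u v
          using Suc.prems(3)[of "u - h" "v - h"] Suc.prems(3)[of "u - h'" "v - h'"] that by (simp add: \<psi>'_def)
        show "norm (\<psi>' u) \<le> 1" for u
          using Suc.prems(4) by (auto simp: \<psi>'_def norm_mult intro!: mult_le_one)
        show "norm (B' i hs) \<le> 1" if "i < Suc s" for i hs
          using Suc.prems(5)[of "Suc i"] that by (auto simp: B'_def norm_mult intro!: mult_le_one)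
        show "B' i (hs[i := y]) = B' i hs" if "i < Suc s" for i hs y
          using Suc.prems(6)[of "Suc i" "h # hs" y] Suc.prems(6)[of "Suc i" "h' # hs" y] that by (simp add: B'_def)
      qed
      finally show ?thesis using False by (simp only: b_def N_def if_False add_0)
    qed
  qed
  also have "(\<Sum>h'\<in>H. \<Sum>h\<in>H. (if int p dvd h - h' then real N ^ Suc s else 0) + b * real N ^ Suc s) =
      real N * (real m * real N ^ Suc s + real N * (b * real N ^ Suc s))"
  proof -
    have "(\<Sum>h\<in>H. if int p dvd h - h' then real N ^ Suc s else 0) = real m * real N ^ Suc s" for h'
    proof -
      have "(\<Sum>h\<in>H. if int p dvd h - h' then real N ^ Suc s else 0) = (\<Sum>h\<in>{h\<in>H. int p dvd h - h'}. real N ^ Suc s)"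
        by (rule sum.inter_filter[symmetric]) (simp add: H_def)
      also have "\<dots> = real m * real N ^ Suc s"
        using card_pairs_cong[OF m(1) p0, of h'] by (simp add: H_def N_def)
      finally show ?thesis .
    qed
    then show ?thesis by (simp add: sum.distrib H_def)
  qed
  also have "real N * (real m * real N ^ Suc s + real N * (b * real N ^ Suc s)) * real (card T) =
      (1 / real p + b) * (real N ^ Suc (Suc s))\<^sup>2"
    using p0 by (simp add: T_def card_tuples N_def power2_eq_square field_simps)
  \<comment> \<open>\<open>1 / p\<close> is absorbed because
    \<open>1 / p \<le> p powr (-1 / 2 ^ s)\<close>. Passing from \<open>S\<^sup>2\<close> to
    \<open>S\<close> halves the exponent of \<open>p\<close>.\<close>
  also have "1 / real p + b \<le> (real (Suc (Suc s)) * real p powr (-1 / 2 ^ Suc s))\<^sup>2"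
  proof -
    define q where "q = real p powr (-1 / 2 ^ Suc s)"
    have qq: "q\<^sup>2 = real p powr (-1 / 2 ^ s)"
      unfolding q_def power2_eq_square powr_add[symmetric] by (simp add: field_simps)
    have "1 / real p = real p powr (-1)" using p0 by (simp add: powr_minus_divide)
    also have "\<dots> \<le> real p powr (-1 / 2 ^ s)" using p0 by (intro powr_mono) (auto simp: field_simps)
    finally have "1 / real p + b \<le> real (Suc (Suc s)) * q\<^sup>2" by (simp add: b_def qq algebra_simps)
    also have "\<dots> \<le> (real (Suc (Suc s)))\<^sup>2 * q\<^sup>2" by (intro mult_right_mono self_le_power) auto
    finally show ?thesis by (simp add: power_mult_distrib q_def)
  qed
  finally have "S\<^sup>2 \<le> (real (Suc (Suc s)) * real p powr (-1 / 2 ^ Suc s) * real N ^ Suc (Suc s))\<^sup>2"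
    by (simp add: power_mult_distrib mult_right_mono del: power_Suc)
  then have "S \<le> real (Suc (Suc s)) * real p powr (-1 / 2 ^ Suc s) * real N ^ Suc (Suc s)"
    by (rule power2_le_imp_le) simp
  then show ?case by (simp only: S_def N_def)
qed

section \<open>Uniformity of the level sets\<close>

text \<open>The balanced function of a level set, on all integers so that arguments such as
  \<open>n - sum_list hs\<close> need no reduction. \<open>\<alpha>\<close> is kept apart from
  \<open>L / p\<close>, from which it will differ by rounding.\<close>

definition level_fun :: "nat \<Rightarrow> nat \<Rightarrow> int \<Rightarrow> (int \<Rightarrow> int) \<Rightarrow> nat \<Rightarrow> real \<Rightarrow> int \<Rightarrow> complex" where
  "level_fun p s w f L \<alpha> n = (if (n ^ s + w * f n) mod int p < int L then 1 else 0) - of_real \<alpha>"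

lemma level_fun_periodic:
  assumes "int (m * p) dvd u - v" "\<And>x y. int m dvd x - y \<Longrightarrow> f x = f y"
  shows "level_fun p s w f L \<alpha> u = level_fun p s w f L \<alpha> v"
proof -
  have "int m dvd u - v" "int p dvd u - v" using assms(1) by (auto intro: dvd_trans[rotated])
  then have "f u = f v" "u mod int p = v mod int p" using assms(2) by (auto simp: mod_eq_dvd_iff)
  then have "(u ^ s + w * f u) mod int p = (v ^ s + w * f v) mod int p"
    by (metis mod_add_left_eq power_mod)
  then show ?thesis by (simp add: level_fun_def)
qed

lemma norm_level_fun_le:
  "0 \<le> \<alpha> \<Longrightarrow> \<alpha> \<le> 1 \<Longrightarrow> norm (level_fun p s w f L \<alpha> n) \<le> 1"
proof -
  assume \<alpha>: "0 \<le> \<alpha>" "\<alpha> \<le> 1"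
  have "level_fun p s w f L \<alpha> n = of_real ((if (n ^ s + w * f n) mod int p < int L then 1 else 0) - \<alpha>)"
    by (simp add: level_fun_def)
  then have "norm (level_fun p s w f L \<alpha> n) = \<bar>(if (n ^ s + w * f n) mod int p < int L then 1 else 0) - \<alpha>\<bar>"
    by (simp only: norm_of_real)
  with \<alpha> show ?thesis by simp
qed

lemma cnj_level_fun: "cnj (level_fun p s w f L \<alpha> n) = level_fun p s w f L \<alpha> n"
  by (simp add: level_fun_def)

text \<open>The logarithm comes from the Fourier coefficients of the interval, the second factor
  from Weyl differencing, and \<open>1 / p\<close> from rounding \<open>\<alpha>\<close> to
  \<open>L / p\<close>.\<close>

definition level_error :: "nat \<Rightarrow> nat \<Rightarrow> real" where
  "level_error s p = (1 + ln (real p)) * (real (Suc s) * real p powr (-1 / 2 ^ s)) + 1 / real p"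

text \<open>Fourier expansion of the interval leaves characters of \<open>\<xi> * n ^ Suc s\<close>
  times an \<open>m\<close>-periodic factor. The coefficient \<open>\<xi> * fact (Suc s)\<close> is
  prime to \<open>p\<close> since \<open>0 < \<xi> < p\<close> and \<open>Suc s < p\<close>, so Weyl
  differencing applies. The bound is uniform in \<open>w\<close> and \<open>f\<close>, which enter
  only the periodic factor.\<close>

lemma level_fun_dual_bound:
  assumes p: "prime p" "Suc s < p" and m: "m > 0" "\<not> p dvd m"
    and f: "\<And>x y. int m dvd x - y \<Longrightarrow> f x = f y"
    and L: "L \<le> p" "\<bar>real L / real p - \<alpha>\<bar> \<le> 1 / real p"
    and B: "\<And>i hs. i < Suc s \<Longrightarrow> norm (B i hs) \<le> 1"
      "\<And>i hs y. i < Suc s \<Longrightarrow> B i (hs[i := y]) = B i hs"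
  shows "norm (\<Sum>hs\<in>tuples (m * p) (Suc s). level_fun p (Suc s) w f L \<alpha> (x - sum_list hs) * (\<Prod>i<Suc s. B i hs))
      \<le> level_error s p * real (m * p) ^ Suc s"
proof -
  have p0: "p > 0" using p by simp
  define N where "N = real (m * p) ^ Suc s"
  have N: "N \<ge> 0" by (simp add: N_def)
  define \<delta> where "\<delta> = real (Suc s) * real p powr (-1 / 2 ^ s)"
  define PB where "PB hs = (\<Prod>i<Suc s. B i hs)" for hs
  have PB: "norm (PB hs) \<le> 1" for hs
    unfolding PB_def prod_norm[symmetric] using B(1) by (intro prod_le_1) auto
  define T where "T \<xi> = (\<Sum>hs\<in>tuples (m * p) (Suc s).
      add_char p (int \<xi> * (x - sum_list hs) ^ Suc s) * add_char p (int \<xi> * (w * f (x - sum_list hs))) * PB hs)" for \<xi>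
  have T: "norm (T \<xi>) \<le> \<delta> * N" if "\<xi> \<in> {1..<p}" for \<xi>
    unfolding T_def \<delta>_def N_def PB_def
  proof (rule box_sum_bound[OF p(1) m])
    have "const_diff (Suc s) (int \<xi> * fact (Suc s)) (\<lambda>x. int \<xi> * x ^ Suc s)"
      using const_diff_scale[OF const_diff_power[of "Suc s" "Suc s"]] by simp
    then show "const_diff (Suc s) (int \<xi> * fact (Suc s)) (\<lambda>x. int \<xi> * x ^ Suc s)" .
    have "\<not> p dvd \<xi>" using that by (auto dest: dvd_imp_le)
    moreover have "\<not> p dvd fact (Suc s)" using p by (simp add: prime_dvd_fact_iff del: fact_Suc)
    ultimately have "\<not> p dvd \<xi> * fact (Suc s)" using p(1) by (simp add: prime_dvd_mult_iff del: fact_Suc)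
    then have "\<not> int p dvd int (\<xi> * fact (Suc s))" by (simp only: int_dvd_int_iff) simp
    then show "\<not> int p dvd int \<xi> * fact (Suc s)" by (simp only: of_nat_mult of_nat_fact not_False_eq_True)
  qed (use f B in auto)
  have split: "level_fun p (Suc s) w f L \<alpha> u =
      (\<Sum>\<xi>=1..<p. interval_coeff p L (int \<xi>) * (add_char p (int \<xi> * u ^ Suc s) * add_char p (int \<xi> * (w * f u))))
      + of_real (real L / real p - \<alpha>)" for u
  proof -
    have "int \<xi> * (u ^ Suc s + w * f u) = int \<xi> * u ^ Suc s + int \<xi> * (w * f u)" for \<xi>
      by (rule distrib_left)
    then have eq: "(if (u ^ Suc s + w * f u) mod int p < int L then 1 else 0) - of_nat L / of_nat p =
      (\<Sum>\<xi>=1..<p. interval_coeff p L (int \<xi>) * (add_char p (int \<xi> * u ^ Suc s) * add_char p (int \<xi> * (w * f u))))"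
      using interval_fourier[OF p0 L(1), of "u ^ Suc s + w * f u"] by (simp only: add_char_add)
    have "level_fun p (Suc s) w f L \<alpha> u = ((if (u ^ Suc s + w * f u) mod int p < int L then 1 else 0) - of_nat L / of_nat p)
        + of_real (real L / real p - \<alpha>)"
      by (simp add: level_fun_def del: power_Suc)
    then show ?thesis unfolding eq .
  qed
  have "(\<Sum>hs\<in>tuples (m * p) (Suc s). level_fun p (Suc s) w f L \<alpha> (x - sum_list hs) * PB hs) =
      (\<Sum>hs\<in>tuples (m * p) (Suc s). \<Sum>\<xi>=1..<p. interval_coeff p L (int \<xi>) * (add_char p (int \<xi> * (x - sum_list hs) ^ Suc s) *
          add_char p (int \<xi> * (w * f (x - sum_list hs))) * PB hs)) +
      (\<Sum>hs\<in>tuples (m * p) (Suc s). of_real (real L / real p - \<alpha>) * PB hs)"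
    unfolding split by (simp only: distrib_right sum.distrib sum_distrib_right mult.assoc)
  also have "\<dots> = (\<Sum>\<xi>=1..<p. interval_coeff p L (int \<xi>) * T \<xi>) +
      (\<Sum>hs\<in>tuples (m * p) (Suc s). of_real (real L / real p - \<alpha>) * PB hs)"
    by (subst sum.swap) (simp only: T_def sum_distrib_left)
  also have "norm \<dots> \<le> norm (\<Sum>\<xi>=1..<p. interval_coeff p L (int \<xi>) * T \<xi>) +
      norm (\<Sum>hs\<in>tuples (m * p) (Suc s). of_real (real L / real p - \<alpha>) * PB hs)" by (rule norm_triangle_ineq)
  also have "norm (\<Sum>\<xi>=1..<p. interval_coeff p L (int \<xi>) * T \<xi>) \<le> (\<Sum>\<xi>=1..<p. norm (interval_coeff p L (int \<xi>)) * (\<delta> * N))"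
    by (intro order_trans[OF norm_sum] sum_mono) (simp add: norm_mult mult_left_mono T)
  also have "\<dots> = (\<Sum>\<xi>=1..<p. norm (interval_coeff p L (int \<xi>))) * (\<delta> * N)" by (simp only: sum_distrib_right)
  also have "\<dots> \<le> (1 + ln p) * (\<delta> * N)"
    using prime_ge_2_nat[OF p(1)] N by (intro mult_right_mono sum_norm_interval_coeff) (auto simp: \<delta>_def)
  also have "norm (\<Sum>hs\<in>tuples (m * p) (Suc s). of_real (real L / real p - \<alpha>) * PB hs) \<le> (\<Sum>hs\<in>tuples (m * p) (Suc s). 1 / real p)"
  proof (intro order_trans[OF norm_sum] sum_mono)
    fix hs
    have "norm (of_real (real L / real p - \<alpha>) * PB hs) = \<bar>real L / real p - \<alpha>\<bar> * norm (PB hs)" by (simp only: norm_mult norm_of_real)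
    also have "\<dots> \<le> 1 / real p * 1" using L PB by (intro mult_mono) auto
    finally show "norm (of_real (real L / real p - \<alpha>) * PB hs) \<le> 1 / real p" by simp
  qed
  also have "\<dots> = 1 / real p * N" by (simp add: card_tuples N_def)
  finally show ?thesis by (simp add: PB_def level_error_def \<delta>_def N_def algebra_simps)
qed

section \<open>Gowers norms and densities of level sets\<close>

lemma norm_foldr_mult_deriv_le:
  assumes "\<And>n. norm (F n) \<le> 1"
  shows "norm (foldr (mult_deriv G) hs F n) \<le> 1"
  using assms by (induction hs arbitrary: n) (auto simp: mult_deriv_def norm_mult intro!: mult_le_one)

text \<open>The factor of the iterated derivative at the vertex \<open>n - \<Sum>hs\<close> of the cube is the only one
  that involves all the steps.\<close>

lemma foldr_mult_deriv_split:
  fixes F :: "int \<Rightarrow> complex" and N :: nat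
  defines "G \<equiv> integer_mod_group N"
  assumes N: "N > 0" and periodic: "\<And>u v. int N dvd u - v \<Longrightarrow> F u = F v"
    and real: "\<And>n. cnj (F n) = F n" and F: "\<And>n. norm (F n) \<le> 1"
  shows "\<exists>B :: int \<Rightarrow> nat \<Rightarrow> int list \<Rightarrow> complex.
      (\<forall>n i hs. i < s \<longrightarrow> norm (B n i hs) \<le> 1) \<and>
      (\<forall>n i hs y. i < s \<longrightarrow> B n i (hs[i := y]) = B n i hs) \<and>
      (\<forall>n. \<forall>hs\<in>tuples N s. foldr (mult_deriv G) hs F n = F (n - sum_list hs) * (\<Prod>i<s. B n i hs))"
proof (induction s)
  case 0
  show ?case by (simp add: tuples_0)
next
  case (Suc s)
  then obtain B where B: "\<And>n i hs. i < s \<Longrightarrow> norm (B n i hs) \<le> 1"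
    "\<And>n i hs y. i < s \<Longrightarrow> B n i (hs[i := y]) = B n i hs"
    "\<And>n hs. hs \<in> tuples N s \<Longrightarrow> foldr (mult_deriv G) hs F n = F (n - sum_list hs) * (\<Prod>i<s. B n i hs)"
    by blast
  \<comment> \<open>The derivative along \<open>h # t\<close> at \<open>n\<close> is the derivative
    along \<open>t\<close> at \<open>n\<close>, which ignores \<open>h\<close>, times the conjugate
    of that at \<open>n - h\<close>, which contains the full vertex. The former becomes the factor
    of index 0.\<close>
  define B' :: "int \<Rightarrow> nat \<Rightarrow> int list \<Rightarrow> complex" where
    "B' n i hs = (case i of 0 \<Rightarrow> foldr (mult_deriv G) (tl hs) F n
       | Suc i' \<Rightarrow> cnj (B (n \<otimes>\<^bsub>G\<^esub> inv\<^bsub>G\<^esub> hd hs) i' (tl hs)))" for n i hs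
  have 1: "norm (B' n i hs) \<le> 1" if "i < Suc s" for n i hs
    using that norm_foldr_mult_deriv_le[OF F] B(1) by (auto simp: B'_def split: nat.split)
  have 2: "B' n i (hs[i := y]) = B' n i hs" if "i < Suc s" for n i hs y
    using that B(2) by (cases hs; cases i) (auto simp: B'_def)
  have 3: "foldr (mult_deriv G) hs F n = F (n - sum_list hs) * (\<Prod>i<Suc s. B' n i hs)" if hs: "hs \<in> tuples N (Suc s)" for n hs
  proof -
    obtain h t where "hs = h # t" using hs by (cases hs) (auto simp: tuples_def)
    then have ht: "hs = h # t" "h \<in> {0..<int N}" "t \<in> tuples N s"
      using hs by (auto simp: tuples_def)
    define n' where "n' = n \<otimes>\<^bsub>G\<^esub> inv\<^bsub>G\<^esub> h"
    have "n' = (n + (- h) mod int N) mod int N"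
      using ht N by (simp add: n'_def G_def carrier_integer_mod_group)
    then have "n' mod int N = (n - h) mod int N" by (simp add: mod_simps)
    then have "int N dvd n' - (n - h)" by (simp add: mod_eq_dvd_iff)
    then have Feq: "F (n' - sum_list t) = F (n - sum_list hs)"
      using ht by (intro periodic) (simp add: algebra_simps)
    have "foldr (mult_deriv G) hs F n = foldr (mult_deriv G) t F n * cnj (foldr (mult_deriv G) t F n')"
      by (simp add: ht mult_deriv_def n'_def)
    also have "cnj (foldr (mult_deriv G) t F n') = F (n - sum_list hs) * (\<Prod>i<s. cnj (B n' i t))"
      using B(3)[OF ht(3), of n'] by (simp add: real Feq)
    also have "foldr (mult_deriv G) t F n * (F (n - sum_list hs) * (\<Prod>i<s. cnj (B n' i t))) = F (n - sum_list hs) * (\<Prod>i<Suc s. B' n i hs)"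
      unfolding prod.lessThan_Suc_shift by (simp add: B'_def ht n'_def)
    finally show ?thesis .
  qed
  show ?case using 1 2 3 by blast
qed

definition level_set :: "nat \<Rightarrow> nat \<Rightarrow> nat \<Rightarrow> int \<Rightarrow> (int \<Rightarrow> int) \<Rightarrow> nat \<Rightarrow> int set" where
  "level_set m p s w f L = {n\<in>{0..<int (m * p)}. (n ^ s + w * f n) mod int p < int L}"

lemma foldr_mult_deriv_cong:
  assumes "N > 0" "\<And>n. n \<in> {0..<int N} \<Longrightarrow> F n = F' n" "n \<in> {0..<int N}"
  shows "foldr (mult_deriv (integer_mod_group N)) hs F n = foldr (mult_deriv (integer_mod_group N)) hs F' n"
  using assms(3)
proof (induction hs arbitrary: n)
  case (Cons h hs)
  have "n \<otimes>\<^bsub>integer_mod_group N\<^esub> inv\<^bsub>integer_mod_group N\<^esub> h \<in> {0..<int N}" using assms(1) by simp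
  then show ?case using Cons by (simp add: mult_deriv_def del: mult_integer_mod_group)
qed (use assms in simp)

text \<open>For each fixed \<open>n\<close> the iterated derivative is the value at one vertex times
  factors that each ignore a step, the shape treated by the dual bound; averaging over
  \<open>n\<close> preserves the bound.\<close>

lemma gowers_norm_level_set_le:
  assumes p: "prime p" "Suc s < p" and m: "m > 0" "\<not> p dvd m"
    and f: "\<And>x y. int m dvd x - y \<Longrightarrow> f x = f y"
    and L: "L \<le> p" "\<bar>real L / real p - \<alpha>\<bar> \<le> 1 / real p"
    and \<alpha>: "0 \<le> \<alpha>" "\<alpha> \<le> 1"
  shows "gowers_norm (integer_mod_group (m * p)) (Suc s)
           (\<lambda>n. indicator (level_set m p (Suc s) w f L) n - complex_of_real \<alpha>)
         \<le> root (2 ^ Suc s) (level_error s p)"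
proof -
  define N where "N = m * p"
  have N: "N > 0" using m p by (simp add: N_def)
  define G where "G = integer_mod_group N"
  define F where "F = level_fun p (Suc s) w f L \<alpha>"
  define F0 where "F0 = (\<lambda>n. indicator (level_set m p (Suc s) w f L) n - complex_of_real \<alpha>)"
  have F0: "F0 n = F n" if "n \<in> {0..<int N}" for n
    using that by (simp add: F0_def F_def level_fun_def level_set_def indicator_def N_def del: power_Suc)
  have carrier: "carrier G = {0..<int N}" using N by (simp add: G_def carrier_integer_mod_group)
  have "F u = F v" if "int N dvd u - v" for u v
    unfolding F_def using that f by (intro level_fun_periodic[where m=m]) (auto simp: N_def)
  then obtain B :: "int \<Rightarrow> nat \<Rightarrow> int list \<Rightarrow> complex" where B:
    "\<And>n i hs. i < Suc s \<Longrightarrow> norm (B n i hs) \<le> 1"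
    "\<And>n i hs y. i < Suc s \<Longrightarrow> B n i (hs[i := y]) = B n i hs"
    "\<And>n hs. hs \<in> tuples N (Suc s) \<Longrightarrow> foldr (mult_deriv G) hs F n = F (n - sum_list hs) * (\<Prod>i<Suc s. B n i hs)"
    using foldr_mult_deriv_split[OF N, of F "Suc s"] cnj_level_fun norm_level_fun_le[OF \<alpha>]
    unfolding G_def F_def by metis
  define M where "M = mean (carrier G \<times> {hs. set hs \<subseteq> carrier G \<and> length hs = Suc s})
     (\<lambda>(n, hs). foldr (mult_deriv G) hs F0 n)"
  have "M = (\<Sum>n\<in>{0..<int N}. \<Sum>hs\<in>tuples N (Suc s). foldr (mult_deriv G) hs F0 n) / (of_nat N * of_nat N ^ Suc s)"
    unfolding M_def mean_def carrier tuples_def[symmetric] sum.cartesian_product[symmetric] card_cartesian_product card_tuples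
    by simp
  also have "(\<Sum>n\<in>{0..<int N}. \<Sum>hs\<in>tuples N (Suc s). foldr (mult_deriv G) hs F0 n) =
      (\<Sum>n\<in>{0..<int N}. \<Sum>hs\<in>tuples N (Suc s). F (n - sum_list hs) * (\<Prod>i<Suc s. B n i hs))"
  proof (intro sum.cong refl)
    fix n hs assume "n \<in> {0..<int N}" "hs \<in> tuples N (Suc s)"
    then show "foldr (mult_deriv G) hs F0 n = F (n - sum_list hs) * (\<Prod>i<Suc s. B n i hs)"
      using foldr_mult_deriv_cong[OF N, of F0 F n hs] F0 B(3) by (simp only: G_def)
  qed
  finally have M: "M = (\<Sum>n\<in>{0..<int N}. \<Sum>hs\<in>tuples N (Suc s). F (n - sum_list hs) * (\<Prod>i<Suc s. B n i hs)) / (of_nat N * of_nat N ^ Suc s)" .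
  have "norm (\<Sum>n\<in>{0..<int N}. \<Sum>hs\<in>tuples N (Suc s). F (n - sum_list hs) * (\<Prod>i<Suc s. B n i hs))
      \<le> (\<Sum>n\<in>{0..<int N}. level_error s p * real N ^ Suc s)"
    unfolding F_def N_def
    by (intro order_trans[OF norm_sum] sum_mono level_fun_dual_bound[OF p m f L]) (use B in auto)
  also have "\<dots> = level_error s p * (real N * real N ^ Suc s)" by simp
  finally have "norm M \<le> level_error s p"
    using N unfolding M norm_divide by (simp add: norm_mult norm_power divide_le_eq del: power_Suc)
  then have "Re M \<le> level_error s p" using complex_Re_le_cmod[of M] by linarith
  then show ?thesis
    unfolding gowers_norm_def M_def F0_def G_def N_def by (intro real_root_le_mono) auto
qed

lemma sum_shift_periodic:
  assumes "N > 0" "\<And>u v. int N dvd u - v \<Longrightarrow> F u = F v"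
  shows "(\<Sum>h\<in>{0..<int N}. F (y - h)) = (\<Sum>n\<in>{0..<int N}. F n)"
proof (rule sum.reindex_bij_witness[of _ "\<lambda>n. (y - n) mod int N" "\<lambda>h. (y - h) mod int N"])
  fix h assume h: "h \<in> {0..<int N}"
  then show "(y - (y - h) mod int N) mod int N = h" "(y - (y - h) mod int N) mod int N = h"
    by (simp_all add: mod_simps)
  show "F ((y - h) mod int N) = F (y - h)" by (rule assms(2)) (simp add: mod_eq_dvd_iff[symmetric])
qed (use assms in auto)

text \<open>The dual bound with all factors equal to 1: the sum over tuples then counts every
  residue \<open>N ^ s\<close> times.\<close>

lemma card_level_set:
  assumes p: "prime p" "Suc s < p" and m: "m > 0" "\<not> p dvd m"
    and f: "\<And>x y. int m dvd x - y \<Longrightarrow> f x = f y"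
    and L: "L \<le> p" "\<bar>real L / real p - \<alpha>\<bar> \<le> 1 / real p"
  shows "real (card (level_set m p (Suc s) w f L)) / real (m * p) \<le> \<alpha> + level_error s p"
proof -
  define N where "N = m * p"
  have N: "N > 0" using m p by (simp add: N_def)
  define F where "F = level_fun p (Suc s) w f L \<alpha>"
  define A where "A = level_set m p (Suc s) w f L"
  have periodic: "F u = F v" if "int N dvd u - v" for u v
    unfolding F_def using that f by (intro level_fun_periodic[where m=m]) (auto simp: N_def)
  have "(\<Sum>hs\<in>tuples N (Suc s). F (0 - sum_list hs)) = (\<Sum>t\<in>tuples N s. \<Sum>h\<in>{0..<int N}. F (- sum_list t - h))"
  proof -
    have "0 - sum_list (h # t) = - sum_list t - h" for h :: int and t by simp
    then show ?thesis by (simp only: sum_tuples_Suc)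
  qed
  also have "\<dots> = of_nat N ^ s * (\<Sum>n\<in>{0..<int N}. F n)"
  proof -
    have "(\<Sum>h\<in>{0..<int N}. F (y - h)) = (\<Sum>n\<in>{0..<int N}. F n)" for y
      by (rule sum_shift_periodic[OF N]) (rule periodic)
    then show ?thesis by (simp add: card_tuples)
  qed
  also have "(\<Sum>n\<in>{0..<int N}. F n) = of_real (real (card A) - real N * \<alpha>)"
  proof -
    have "(\<Sum>n\<in>{0..<int N}. F n) = (\<Sum>n\<in>{0..<int N}. if (n ^ Suc s + w * f n) mod int p < int L then 1 else 0) - of_nat N * of_real \<alpha>"
      by (simp add: F_def level_fun_def sum_subtractf del: power_Suc)
    also have "(\<Sum>n\<in>{0..<int N}. if (n ^ Suc s + w * f n) mod int p < int L then 1 else (0::complex)) = of_nat (card A)"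
      unfolding A_def level_set_def N_def by (subst sum.inter_filter[symmetric]) simp_all
    finally show ?thesis by simp
  qed
  finally have "norm (of_nat N ^ s * complex_of_real (real (card A) - real N * \<alpha>)) =
      norm (\<Sum>hs\<in>tuples (m * p) (Suc s). level_fun p (Suc s) w f L \<alpha> (0 - sum_list hs) * (\<Prod>i<Suc s. 1))"
    by (simp add: F_def N_def)
  also have "\<dots> \<le> level_error s p * real (m * p) ^ Suc s"
    by (rule level_fun_dual_bound[OF p m f L]) auto
  finally have "real N ^ s * \<bar>real (card A) - real N * \<alpha>\<bar> \<le> real N ^ s * (level_error s p * real N)"
    by (simp only: norm_mult norm_power norm_of_nat norm_of_real N_def power_Suc mult_ac)
  then have "\<bar>real (card A) - real N * \<alpha>\<bar> \<le> level_error s p * real N" using N by simp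
  then have "real (card A) \<le> (\<alpha> + level_error s p) * real N" by (simp add: algebra_simps)
  then show ?thesis using N by (simp add: A_def N_def divide_le_eq)
qed

section \<open>Counting patterns in cyclic groups\<close>

lemma pattern_avg_indicator:
  assumes "N > 0"
  shows "Re (pattern_avg (integer_mod_group N) a (indicator A)) =
     real (card {(n, d). n \<in> {0..<int N} \<and> d \<in> {0..<int N} \<and> (\<forall>i<length a. (n + a ! i * d) mod int N \<in> A)}) / (real N)\<^sup>2"
proof -
  define S where "S = {(n, d). n \<in> {0..<int N} \<and> d \<in> {0..<int N} \<and> (\<forall>i<length a. (n + a ! i * d) mod int N \<in> A)}"
  have sub: "S \<subseteq> {0..<int N} \<times> {0..<int N}" by (auto simp: S_def)
  have "(\<Prod>i<length a. indicator A ((n + a ! i * d) mod int N)) = (indicator S (n, d) :: complex)"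
    if "n \<in> {0..<int N}" "d \<in> {0..<int N}" for n d
    using that by (auto simp: S_def indicator_def)
  then have "pattern_avg (integer_mod_group N) a (indicator A) =
      (\<Sum>(n, d)\<in>{0..<int N} \<times> {0..<int N}. indicator S (n, d)) / of_nat (N * N)"
    using assms unfolding pattern_avg_def mean_def
    by (auto simp: carrier_integer_mod_group int_pow_integer_mod_group mod_add_right_eq card_cartesian_product intro!: sum.cong)
  also have "(\<Sum>(n, d)\<in>{0..<int N} \<times> {0..<int N}. indicator S (n, d)) = (of_nat (card S) :: complex)"
    using sub by (simp add: case_prod_eta indicator_def sum.If_cases Int_absorb1 split_def)
  finally have "pattern_avg (integer_mod_group N) a (indicator A) = of_real (real (card S) / (real N)\<^sup>2)"
    by (simp add: power2_eq_square)
  then show ?thesis by (simp only: Re_complex_of_real S_def)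
qed

text \<open>A pattern is determined by its difference and its first point, and the latter lies in
  \<open>A\<close>.\<close>

lemma pattern_avg_le_density:
  assumes N: "N > 0" and a: "a \<noteq> []" and A: "A \<subseteq> {0..<int N}"
  shows "Re (pattern_avg (integer_mod_group N) a (indicator A)) \<le> real (card A) / real N"
proof -
  define S where "S = {(n, d). n \<in> {0..<int N} \<and> d \<in> {0..<int N} \<and> (\<forall>i<length a. (n + a ! i * d) mod int N \<in> A)}"
  have "finite A" using A finite_subset by blast
  have "inj_on (\<lambda>(n, d). ((n + a ! 0 * d) mod int N, d)) S"
  proof (rule inj_onI)
    fix x y assume *: "x \<in> S" "y \<in> S" "(\<lambda>(n, d). ((n + a ! 0 * d) mod int N, d)) x = (\<lambda>(n, d). ((n + a ! 0 * d) mod int N, d)) y"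
    obtain n d n' d' where xy: "x = (n, d)" "y = (n', d')" by (cases x, cases y) blast
    then have d: "d = d'" "(n + a ! 0 * d) mod int N = (n' + a ! 0 * d) mod int N" using * by auto
    then have "n mod int N = n' mod int N" by (simp add: mod_eq_dvd_iff)
    then show "x = y" using * xy d by (simp add: S_def)
  qed
  moreover have "(\<lambda>(n, d). ((n + a ! 0 * d) mod int N, d)) ` S \<subseteq> A \<times> {0..<int N}"
    using a by (auto simp: S_def)
  ultimately have "card S \<le> card (A \<times> {0..<int N})" using \<open>finite A\<close> by (intro card_inj_on_le) auto
  then have "real (card S) \<le> real (card A) * real N" by (simp add: card_cartesian_product flip: of_nat_mult)
  then show ?thesis
    unfolding pattern_avg_indicator[OF N] S_def[symmetric] using N by (simp add: field_simps power2_eq_square)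
qed

lemma pattern_avg_le_inverse:
  assumes m: "m > 0" and p: "p > 0"
    and A: "\<And>n d. \<forall>i<length a. (n + a ! i * d) mod int (m * p) \<in> A \<Longrightarrow> int m dvd d"
  shows "Re (pattern_avg (integer_mod_group (m * p)) a (indicator A)) \<le> 1 / real m"
proof -
  define N where "N = m * p"
  have N: "N > 0" using m p by (simp add: N_def)
  define S where "S = {(n, d). n \<in> {0..<int N} \<and> d \<in> {0..<int N} \<and> (\<forall>i<length a. (n + a ! i * d) mod int N \<in> A)}"
  have "S \<subseteq> {0..<int N} \<times> {d\<in>{0..<int (p * m)}. int m dvd d - 0}"
    using A by (auto simp: S_def N_def mult.commute)
  moreover have "finite {d\<in>{0..<int (p * m)}. int m dvd d - 0}" by (rule finite_subset[of _ "{0..<int (p * m)}"]) auto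
  ultimately have "card S \<le> card ({0..<int N} \<times> {d\<in>{0..<int (p * m)}. int m dvd d - 0})"
    by (intro card_mono finite_cartesian_product finite_atLeastLessThan_int)
  also have "\<dots> = N * p" unfolding card_cartesian_product card_pairs_cong[OF p m] by simp
  finally have "real (card S) \<le> real N * real p" by (simp flip: of_nat_mult)
  then have "real (card S) / (real N)\<^sup>2 \<le> real N * real p / (real N)\<^sup>2" by (intro divide_right_mono) auto
  also have "\<dots> = 1 / real m" using m p by (simp add: N_def power2_eq_square)
  finally show ?thesis unfolding N_def[symmetric] pattern_avg_indicator[OF N] S_def .
qed

text \<open>Modulo \<open>p\<close> the weights eliminate the polynomial, leaving
  \<open>w * \<sigma>\<close> congruent to \<open>\<Sum> c i * u i\<close> with residues
  \<open>u i < L\<close>. If \<open>\<sigma> \<noteq> 0\<close>, then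
  \<open>w \<le> \<bar>w * \<sigma>\<bar> \<le> p / 2\<close> while the other side is below
  \<open>w\<close> in absolute value; the difference is then nonzero and smaller than
  \<open>p\<close>.\<close>

lemma level_set_relation:
  fixes a :: "int list" and c :: "nat \<Rightarrow> int" and H w C :: int
  assumes p: "p > 0" and m: "m > 0"
    and c: "\<And>e. e \<le> s \<Longrightarrow> (\<Sum>i<length a. c i * a ! i ^ e) = 0"
    and C: "C = (\<Sum>i<length a. \<bar>c i\<bar>)" "C \<ge> 1"
    and f: "\<And>x y. int m dvd x - y \<Longrightarrow> f x = f y" "\<And>n. 0 \<le> f n \<and> f n \<le> H"
    and w: "C * int L \<le> w" "2 * C * H * w \<le> int p"
    and A: "\<forall>i<length a. (n + a ! i * d) mod int (m * p) \<in> level_set m p s w f L"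
  shows "(\<Sum>i<length a. c i * f (n + a ! i * d)) = 0"
proof (rule ccontr)
  let ?k = "length a"
  define \<sigma> where "\<sigma> = (\<Sum>i<?k. c i * f (n + a ! i * d))"
  assume "(\<Sum>i<?k. c i * f (n + a ! i * d)) \<noteq> 0"
  then have \<sigma>: "\<sigma> \<noteq> 0" by (simp add: \<sigma>_def)
  define u where "u i = ((n + a ! i * d) ^ s + w * f (n + a ! i * d)) mod int p" for i
  have u: "0 \<le> u i \<and> u i < int L" if "i < ?k" for i
  proof -
    let ?x = "n + a ! i * d"
    have "int (m * p) dvd ?x mod int (m * p) - ?x" by (simp add: mod_eq_dvd_iff[symmetric] del: of_nat_mult)
    then have dvd: "int m dvd ?x mod int (m * p) - ?x" "int p dvd ?x mod int (m * p) - ?x"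
      by (auto intro: dvd_trans[rotated])
    then have "(?x mod int (m * p)) mod int p = ?x mod int p" by (simp only: mod_eq_dvd_iff)
    then have "(?x mod int (m * p)) ^ s mod int p = ?x ^ s mod int p" by (metis power_mod)
    then have "((?x mod int (m * p)) ^ s + w * f ?x) mod int p = u i"
      unfolding u_def by (metis mod_add_left_eq)
    then have "((?x mod int (m * p)) ^ s + w * f (?x mod int (m * p))) mod int p = u i"
      by (simp only: f(1)[OF dvd(1)])
    then have "u i < int L" using A that by (auto simp: level_set_def)
    then show ?thesis using p by (simp add: u_def)
  qed
  have poly: "(\<Sum>i<?k. c i * (n + a ! i * d) ^ s) = 0"
  proof -
    have "(\<Sum>i<?k. c i * (n + a ! i * d) ^ s) = (\<Sum>i<?k. \<Sum>e\<le>s. c i * (of_nat (s choose e) * (a ! i * d) ^ e * n ^ (s - e)))"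
      by (simp add: add.commute[of n] binomial_ring sum_distrib_left)
    also have "\<dots> = (\<Sum>e\<le>s. of_nat (s choose e) * d ^ e * n ^ (s - e) * (\<Sum>i<?k. c i * a ! i ^ e))"
      by (subst sum.swap) (simp add: sum_distrib_left power_mult_distrib mult_ac)
    also have "\<dots> = 0" using c by simp
    finally show ?thesis .
  qed
  have "(\<Sum>i<?k. c i * (((n + a ! i * d) ^ s + w * f (n + a ! i * d)) - u i)) = w * \<sigma> - (\<Sum>i<?k. c i * u i)"
    using poly by (simp add: \<sigma>_def algebra_simps sum.distrib sum_subtractf sum_distrib_left)
  moreover have "int p dvd (\<Sum>i<?k. c i * (((n + a ! i * d) ^ s + w * f (n + a ! i * d)) - u i))"
    by (intro dvd_sum dvd_mult) (simp add: u_def minus_mod_eq_mult_div)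
  ultimately have dvd: "int p dvd w * \<sigma> - (\<Sum>i<?k. c i * u i)" by simp
  have L: "L \<ge> 1"
  proof -
    have "?k \<noteq> 0" using C by (cases "?k = 0") auto
    then show ?thesis using u[of 0] by auto
  qed
  \<comment> \<open>The integral bound \<open>L - 1\<close> makes the estimate strict:
    \<open>C * (L - 1) < C * L \<le> w\<close>.\<close>
  have "\<bar>\<Sum>i<?k. c i * u i\<bar> \<le> (\<Sum>i<?k. \<bar>c i\<bar> * (int L - 1))"
  proof (intro order_trans[OF sum_abs] sum_mono)
    fix i assume "i \<in> {..<?k}"
    then show "\<bar>c i * u i\<bar> \<le> \<bar>c i\<bar> * (int L - 1)" using u[of i] by (simp add: abs_mult mult_left_mono)
  qed
  also have "\<dots> = C * (int L - 1)" by (simp only: C(1) sum_distrib_right)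
  also have "\<dots> = C * int L - C" by (simp add: algebra_simps)
  finally have cu: "\<bar>\<Sum>i<?k. c i * u i\<bar> < w" using w C by linarith
  then have w0: "w > 0" by linarith
  have "\<bar>\<sigma>\<bar> \<le> (\<Sum>i<?k. \<bar>c i\<bar> * H)" unfolding \<sigma>_def
  proof (intro order_trans[OF sum_abs] sum_mono)
    fix i show "\<bar>c i * f (n + a ! i * d)\<bar> \<le> \<bar>c i\<bar> * H" using f(2) by (simp add: abs_mult mult_left_mono)
  qed
  also have "\<dots> = C * H" by (simp add: C sum_distrib_right)
  finally have "\<bar>\<sigma>\<bar> \<le> C * H" .
  then have "w * \<bar>\<sigma>\<bar> \<le> w * (C * H)" using w0 by (intro mult_left_mono) auto
  also have "2 * (w * (C * H)) \<le> int p" using w(2) by (simp add: mult_ac)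
  finally have up: "2 * (w * \<bar>\<sigma>\<bar>) \<le> int p" by simp
  have "w * 1 \<le> w * \<bar>\<sigma>\<bar>" using w0 \<sigma> by (intro mult_left_mono) auto
  then have low: "w \<le> \<bar>w * \<sigma>\<bar>" "2 * \<bar>w * \<sigma>\<bar> \<le> int p" using up w0 by (auto simp: abs_mult)
  define X where "X = w * \<sigma>"
  define Y where "Y = (\<Sum>i<?k. c i * u i)"
  have "\<bar>Y\<bar> < w" "w \<le> \<bar>X\<bar>" "2 * \<bar>X\<bar> \<le> int p" "int p dvd X - Y" using cu low dvd by (auto simp: X_def Y_def)
  then have "X - Y \<noteq> 0" "\<bar>X - Y\<bar> < \<bar>int p\<bar>" by linarith+
  then show False using \<open>int p dvd X - Y\<close> by (meson dvd_imp_le_int linorder_not_less)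
qed

section \<open>Bounds for the pattern density\<close>

lemma rho_bound_zero: "rho_bound a \<alpha> 0"
  unfolding rho_bound_def
proof (intro allI impI exI conjI)
  fix \<epsilon> :: real and N :: nat and A :: "int set"
  assume "\<epsilon> > 0" "0 < N \<and> 0 \<le> N \<and> A \<subseteq> carrier (integer_mod_group N) \<and>
        gowers_norm (integer_mod_group N) (length a - 2) (\<lambda>n. indicator A n - complex_of_real \<alpha>) \<le> 1"
  then show "0 - \<epsilon> \<le> Re (pattern_avg (integer_mod_group N) a (indicator A))"
    by (simp add: pattern_avg_indicator) (smt (verit) divide_nonneg_nonneg of_nat_0_le_iff zero_le_power2)
qed simp

text \<open>The admissible bounds are closed under suprema, so that \<open>GREATEST\<close> is not junk.\<close>

lemma rho_le:
  assumes "\<And>r. rho_bound a \<alpha> r \<Longrightarrow> r \<le> b"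
  shows "rho a \<alpha> \<le> b"
proof -
  define R where "R = {r. rho_bound a \<alpha> r}"
  have R: "R \<noteq> {}" "bdd_above R"
    using rho_bound_zero by (auto simp: R_def intro: bdd_aboveI[of _ b] assms)
  have "rho_bound a \<alpha> (Sup R)"
    unfolding rho_bound_def
  proof (intro allI impI)
    fix \<epsilon> :: real assume \<epsilon>: "\<epsilon> > 0"
    then obtain r where r: "rho_bound a \<alpha> r" "Sup R - \<epsilon> / 2 < r"
      using less_cSup_iff[OF R, of "Sup R - \<epsilon> / 2"] by (auto simp: R_def)
    then obtain \<eta> N0 where "\<eta> > 0" and *: "\<And>N A. 0 < N \<and> N0 \<le> N \<and> A \<subseteq> carrier (integer_mod_group N) \<and>
        gowers_norm (integer_mod_group N) (length a - 2) (\<lambda>n. indicator A n - complex_of_real \<alpha>) \<le> \<eta>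
        \<Longrightarrow> Re (pattern_avg (integer_mod_group N) a (indicator A)) \<ge> r - \<epsilon> / 2"
      unfolding rho_bound_def using \<epsilon> half_gt_zero by blast
    show "\<exists>\<eta>>0. \<exists>N0. \<forall>N A. 0 < N \<and> N0 \<le> N \<and> A \<subseteq> carrier (integer_mod_group N) \<and>
        gowers_norm (integer_mod_group N) (length a - 2) (\<lambda>n. indicator A n - complex_of_real \<alpha>) \<le> \<eta> \<longrightarrow>
        Sup R - \<epsilon> \<le> Re (pattern_avg (integer_mod_group N) a (indicator A))"
    proof (intro exI[of _ \<eta>] conjI exI[of _ N0] allI impI)
      fix N A assume "0 < N \<and> N0 \<le> N \<and> A \<subseteq> carrier (integer_mod_group N) \<and>
        gowers_norm (integer_mod_group N) (length a - 2) (\<lambda>n. indicator A n - complex_of_real \<alpha>) \<le> \<eta>"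
      from *[OF this] r(2) show "Sup R - \<epsilon> \<le> Re (pattern_avg (integer_mod_group N) a (indicator A))"
        by linarith
    qed fact
  qed
  moreover have "r \<le> Sup R" if "rho_bound a \<alpha> r" for r
    using that R by (intro cSup_upper) (auto simp: R_def)
  ultimately have "rho a \<alpha> = Sup R" unfolding rho_def by (intro Greatest_equality) auto
  then show ?thesis using R assms by (auto simp: R_def intro: cSup_least)
qed

lemma level_error_tendsto: "(\<lambda>p. level_error s p) \<longlonglongrightarrow> 0"
proof -
  define e :: real where "e = 1 / 2 ^ s"
  have e: "e > 0" by (simp add: e_def)
  have "((\<lambda>x::real. (1 + ln x) * (x powr (- e)) * c) \<longlongrightarrow> 0) at_top" for c :: real
    using e by real_asymp
  moreover have "((\<lambda>x::real. 1 / x) \<longlongrightarrow> 0) at_top" by real_asymp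
  ultimately have "((\<lambda>x::real. (1 + ln x) * (x powr (- e)) * real (Suc s) + 1 / x) \<longlongrightarrow> 0 + 0) at_top"
    by (rule tendsto_add)
  then have "((\<lambda>x::real. (1 + ln x) * (real (Suc s) * x powr (- e)) + 1 / x) \<longlongrightarrow> 0) at_top"
    by (simp only: mult_ac add_0)
  then have "(\<lambda>p. (1 + ln (real p)) * (real (Suc s) * real p powr (- e)) + 1 / real p) \<longlonglongrightarrow> 0"
    by (rule filterlim_compose[OF _ filterlim_real_sequentially])
  then show ?thesis by (simp add: level_error_def e_def)
qed

text \<open>With \<open>m\<close> and \<open>f\<close> fixed, the level sets become uniform as
  \<open>p\<close> grows and so test every admissible \<open>r\<close>. The parameter
  \<open>w\<close> may vary with \<open>p\<close> because the error does not involve it.\<close>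

lemma rho_bound_level_sets:
  fixes w :: "nat \<Rightarrow> int"
  assumes r: "rho_bound a \<alpha> r" and k: "length a = s + 3" and \<alpha>: "0 < \<alpha>" "\<alpha> < 1"
    and m: "m > 0" and f: "\<And>x y. int m dvd x - y \<Longrightarrow> f x = f y" and \<epsilon>: "\<epsilon> > 0"
  obtains p0 where "\<And>p. prime p \<Longrightarrow> p \<ge> p0 \<Longrightarrow>
      r - \<epsilon> \<le> Re (pattern_avg (integer_mod_group (m * p)) a (indicator (level_set m p (Suc s) (w p) f (nat \<lfloor>\<alpha> * real p\<rfloor>)))) \<and>
      real (card (level_set m p (Suc s) (w p) f (nat \<lfloor>\<alpha> * real p\<rfloor>))) / real (m * p) \<le> \<alpha> + \<epsilon>"
proof -
  obtain \<eta> N0 where \<eta>: "\<eta> > 0" and *: "\<And>N A. 0 < N \<and> N0 \<le> N \<and> A \<subseteq> carrier (integer_mod_group N) \<and>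
        gowers_norm (integer_mod_group N) (length a - 2) (\<lambda>n. indicator A n - complex_of_real \<alpha>) \<le> \<eta>
        \<Longrightarrow> Re (pattern_avg (integer_mod_group N) a (indicator A)) \<ge> r - \<epsilon>"
    using r \<epsilon> unfolding rho_bound_def by blast
  have "min (\<eta> ^ 2 ^ Suc s) \<epsilon> > 0" using \<eta> \<epsilon> by simp
  then have "\<forall>\<^sub>F p in sequentially. level_error s p < min (\<eta> ^ 2 ^ Suc s) \<epsilon>"
    using order_tendstoD(2)[OF level_error_tendsto] by blast
  then obtain p1 where p1: "\<And>p. p \<ge> p1 \<Longrightarrow> level_error s p < min (\<eta> ^ 2 ^ Suc s) \<epsilon>"
    by (auto simp: eventually_sequentially)
  \<comment> \<open>The prime exceeds \<open>m\<close>, so it does not divide \<open>m\<close>; it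
    exceeds \<open>Suc s\<close>, so it does not divide the factorial; and
    \<open>m * p \<ge> N0\<close>.\<close>
  show ?thesis
  proof (rule that[of "p1 + N0 + m + s + 2"])
    fix p :: nat assume p: "prime p" "p \<ge> p1 + N0 + m + s + 2"
    then have p': "Suc s < p" "\<not> p dvd m" "p \<ge> p1" "p > 0" "m * p \<ge> N0" using m
      by (auto dest: dvd_imp_le intro: order_trans[of N0 p "m * p"])
    define L where "L = nat \<lfloor>\<alpha> * real p\<rfloor>"
    define A where "A = level_set m p (Suc s) (w p) f L"
    have fl: "real L = real_of_int \<lfloor>\<alpha> * real p\<rfloor>" using \<alpha> by (simp add: L_def)
    have "\<alpha> * real p \<le> 1 * real p" using \<alpha> by (intro mult_right_mono) auto
    then have "real L \<le> \<alpha> * real p" "\<alpha> * real p < real L + 1" "real L \<le> real p" unfolding fl by linarith+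
    then have "L \<le> p" "real L / real p \<le> \<alpha>" "\<alpha> \<le> (real L + 1) / real p"
      using p'(4) by (simp_all add: pos_divide_le_eq pos_le_divide_eq)
    then have L: "L \<le> p" "\<bar>real L / real p - \<alpha>\<bar> \<le> 1 / real p"
      by (auto simp: abs_le_iff add_divide_distrib)
    have A: "A \<subseteq> carrier (integer_mod_group (m * p))"
      using m p' by (auto simp: A_def level_set_def carrier_integer_mod_group)
    have "gowers_norm (integer_mod_group (m * p)) (Suc s) (\<lambda>n. indicator A n - complex_of_real \<alpha>)
        \<le> root (2 ^ Suc s) (level_error s p)"
      unfolding A_def by (rule gowers_norm_level_set_le[OF p(1) p'(1) m p'(2) f L]) (use \<alpha> in auto)
    also have "\<dots> \<le> root (2 ^ Suc s) (\<eta> ^ 2 ^ Suc s)"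
      using p1[OF p'(3)] by (intro real_root_le_mono) (auto simp del: power_Suc)
    also have "\<dots> = \<eta>" using \<eta> by (intro real_root_power_cancel) auto
    finally have "r - \<epsilon> \<le> Re (pattern_avg (integer_mod_group (m * p)) a (indicator A))"
      using * [of "m * p" A] A m p' k by simp
    moreover have "real (card A) / real (m * p) \<le> \<alpha> + level_error s p"
      unfolding A_def by (rule card_level_set[OF p(1) p'(1) m p'(2) f L])
    then have "real (card A) / real (m * p) \<le> \<alpha> + \<epsilon>" using p1[OF p'(3)] by simp
    ultimately show "r - \<epsilon> \<le> Re (pattern_avg (integer_mod_group (m * p)) a (indicator (level_set m p (Suc s) (w p) f (nat \<lfloor>\<alpha> * real p\<rfloor>)))) \<and>
      real (card (level_set m p (Suc s) (w p) f (nat \<lfloor>\<alpha> * real p\<rfloor>))) / real (m * p) \<le> \<alpha> + \<epsilon>"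
      by (simp only: A_def L_def)
  qed
qed

text \<open>The case \<open>m = 1\<close>, \<open>f = 0\<close> already gives uniform sets of
  density about \<open>\<alpha>\<close>, and the density bounds the pattern average. This serves the
  values of \<open>\<alpha>\<close> that are not small.\<close>

lemma rho_bound_le_density:
  assumes r: "rho_bound a \<alpha> r" and k: "length a = s + 3" and \<alpha>: "0 < \<alpha>" "\<alpha> < 1"
  shows "r \<le> \<alpha>"
proof (rule field_le_epsilon)
  fix \<epsilon> :: real assume "\<epsilon> > 0"
  then have \<epsilon>: "\<epsilon> / 2 > 0" by simp
  obtain p0 where p0: "\<And>p. prime p \<Longrightarrow> p \<ge> p0 \<Longrightarrow>
      r - \<epsilon> / 2 \<le> Re (pattern_avg (integer_mod_group (1 * p)) a (indicator (level_set 1 p (Suc s) 0 (\<lambda>_. 0) (nat \<lfloor>\<alpha> * real p\<rfloor>)))) \<and>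
      real (card (level_set 1 p (Suc s) 0 (\<lambda>_. 0) (nat \<lfloor>\<alpha> * real p\<rfloor>))) / real (1 * p) \<le> \<alpha> + \<epsilon> / 2"
    by (rule rho_bound_level_sets[OF r k \<alpha> zero_less_one _ \<epsilon>, where f = "\<lambda>_. 0" and w = "\<lambda>_. 0"]) auto
  obtain p where p: "prime p" "p > p0" using bigger_prime by blast
  define A where "A = level_set 1 p (Suc s) 0 (\<lambda>_. 0) (nat \<lfloor>\<alpha> * real p\<rfloor>)"
  have "Re (pattern_avg (integer_mod_group (1 * p)) a (indicator A)) \<le> real (card A) / real (1 * p)"
    by (rule pattern_avg_le_density) (use p k prime_gt_0_nat[of p] in \<open>auto simp: A_def level_set_def\<close>)
  then show "r \<le> \<alpha> + \<epsilon>" using p0[of p] p by (simp add: A_def)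
qed

text \<open>The multiplier \<open>w\<close> has to lie between \<open>C * L\<close>, where
  \<open>L \<le> \<alpha> * p\<close>, and \<open>p / (2 * C * H)\<close>. The assumption
  \<open>small\<close> opens this window for large \<open>p\<close>.\<close>

lemma rho_bound_le_inverse:
  fixes c :: "nat \<Rightarrow> int" and C H :: nat
  assumes r: "rho_bound a \<alpha> r" and k: "length a = s + 3" and \<alpha>: "0 < \<alpha>" "\<alpha> < 1"
    and c: "\<And>e. e \<le> Suc s \<Longrightarrow> (\<Sum>i<length a. c i * a ! i ^ e) = 0"
    and C: "int C = (\<Sum>i<length a. \<bar>c i\<bar>)" "C \<ge> 1"
    and m: "m > 0"
    and f: "\<And>x y. int m dvd x - y \<Longrightarrow> f x = f y" "\<And>n. 0 \<le> f n \<and> f n \<le> int H" and H: "H \<ge> 1"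
    and detect: "\<And>n d. (\<Sum>i<length a. c i * f (n + a ! i * d)) = 0 \<Longrightarrow> int m dvd d"
    and small: "2 * real C ^ 2 * real H * \<alpha> < 1"
  shows "r \<le> 1 / real m"
proof (rule field_le_epsilon)
  fix \<epsilon> :: real assume \<epsilon>: "\<epsilon> > 0"
  \<comment> \<open>\<open>w p\<close> is the upper end of the window, rounded down. The window has
    width at least \<open>g * p\<close>, and \<open>p \<ge> 1 / g\<close> makes up for the
    rounding.\<close>
  define w where "w p = int (p div (2 * C * H))" for p
  define g where "g = 1 / (2 * real C * real H) - real C * \<alpha>"
  have g: "g > 0"
  proof -
    have "real C * \<alpha> * (2 * real C * real H) < 1" using small by (simp add: power2_eq_square mult_ac)
    then show ?thesis using C(2) H by (simp add: g_def pos_less_divide_eq)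
  qed
  obtain p0 where p0: "\<And>p. prime p \<Longrightarrow> p \<ge> p0 \<Longrightarrow>
      r - \<epsilon> \<le> Re (pattern_avg (integer_mod_group (m * p)) a (indicator (level_set m p (Suc s) (w p) f (nat \<lfloor>\<alpha> * real p\<rfloor>)))) \<and>
      real (card (level_set m p (Suc s) (w p) f (nat \<lfloor>\<alpha> * real p\<rfloor>))) / real (m * p) \<le> \<alpha> + \<epsilon>"
    by (rule rho_bound_level_sets[OF r k \<alpha> m _ \<epsilon>, where f = f and w = w]) (use f in auto)
  obtain p where p: "prime p" "p > p0 + nat \<lceil>1 / g\<rceil>" using bigger_prime by blast
  have p_pos: "p > 0" using p by simp
  have "1 / g \<le> real p" using p(2) by linarith
  then have gp: "1 \<le> real p * g" using g by (simp add: pos_divide_le_eq)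
  define L where "L = nat \<lfloor>\<alpha> * real p\<rfloor>"
  have L: "real L \<le> \<alpha> * real p" using \<alpha> by (simp add: L_def)
  have "Re (pattern_avg (integer_mod_group (m * p)) a (indicator (level_set m p (Suc s) (w p) f L))) \<le> 1 / real m"
  proof (rule pattern_avg_le_inverse[OF m p_pos])
    fix n d assume A: "\<forall>i<length a. (n + a ! i * d) mod int (m * p) \<in> level_set m p (Suc s) (w p) f L"
    define q where "q = 2 * C * H"
    have q: "q > 0" using C(2) H by (simp add: q_def)
    have "real p = real q * real (p div q) + real (p mod q)" by (metis mult_div_mod_eq of_nat_add of_nat_mult)
    moreover have "real (p mod q) < real q" using q by simp
    ultimately have "real p < (real (p div q) + 1) * real q" by (simp add: algebra_simps)
    then have "real p / real q < real (p div q) + 1" using q by (simp add: pos_divide_less_eq)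
    moreover have "real p * g = real p / real q - real C * (\<alpha> * real p)" by (simp add: g_def q_def algebra_simps)
    moreover have "real C * real L \<le> real C * (\<alpha> * real p)" using L by (intro mult_left_mono) auto
    ultimately have "real C * real L \<le> real (p div q)" using gp by linarith
    then have "real (C * L) \<le> real (p div (2 * C * H))" by (simp add: q_def)
    then have w1: "int C * int L \<le> w p" by (simp add: w_def flip: of_nat_mult)
    have "2 * C * H * (p div (2 * C * H)) \<le> p" by simp
    then have w2: "2 * int C * int H * w p \<le> int p" unfolding w_def by (metis of_nat_le_iff of_nat_mult of_nat_numeral)
    have C1: "int C \<ge> 1" using C(2) by simp
    show "int m dvd d"
      by (rule detect, rule level_set_relation[OF p_pos m c C(1) C1 f w1 w2 A])
  qed
  then show "r \<le> 1 / real m + \<epsilon>" using p0[of p] p by (simp add: L_def)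
qed

section \<open>The number of moduli in terms of \<open>\<alpha>\<close>\<close>

theorem theorem1p20:
  fixes k :: nat and a :: "int list"
  assumes "k \<ge> 4"
    and "length a = k"
    and "sorted_wrt (<) a"
    and "odd k \<or> \<not> symmetric_pattern a"
  shows "\<exists>c>0. \<forall>\<alpha>::real. 0 < \<alpha> \<and> \<alpha> < 1/2 \<longrightarrow>
           rho a \<alpha> < \<alpha> powr (c * ln (1 / \<alpha>))"
proof -
  have asym: "\<not> symmetric_pattern a" using assms(2,4) by (auto simp: symmetric_pattern_def)
  \<comment> \<open>Thus \<open>Suc s = k - 2\<close> is both the order of the Gowers norm and the
    largest degree that the weights annihilate.\<close>
  define s where "s = k - 3"
  have s: "length a = s + 3" using assms(1,2) by (simp add: s_def)
  have mono: "a ! i < a ! j" if "i < j" "j < k" for i j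
    using assms(2,3) that by (simp add: sorted_wrt_iff_nth_less)
  have k2: "k \<ge> 2" using assms(1) by simp
  obtain c where c: "\<And>e. e < k - 1 \<Longrightarrow> (\<Sum>i<k. c i * a ! i ^ e) = 0"
      "\<And>r. 0 < r \<Longrightarrow> r < k \<Longrightarrow> (\<Sum>i<r. c i) \<noteq> 0"
      "\<And>i. i < k \<Longrightarrow> c i \<noteq> 0"
    using annihilating_weights[where a = "\<lambda>i. a ! i" and k = k] mono k2 by metis
  have total: "(\<Sum>i<k. c i) = 0" using c(1)[of 0] k2 by simp
  obtain E :: nat where E: "E \<ge> 2" and detect: "\<And>J. J \<ge> 1 \<Longrightarrow> \<exists>(m::nat) f. 4 ^ (J * J) \<le> m \<and>
          (\<forall>n. 0 \<le> f n \<and> f n \<le> int E ^ J) \<and>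
          (\<forall>x y. int m dvd x - y \<longrightarrow> f x = f y) \<and>
          (\<forall>n d. (\<Sum>i<k. c i * f (n + a ! i * d)) = 0 \<longrightarrow> int m dvd d)"
    by (rule detecting_function[OF assms(3) assms(2)[symmetric] k2 asym total]) (use c in blast)+
  define C where "C = nat (\<Sum>i<k. \<bar>c i\<bar>)"
  have C: "int C = (\<Sum>i<length a. \<bar>c i\<bar>)" by (simp add: C_def assms(2) sum_nonneg)
  have "\<bar>c 0\<bar> \<le> (\<Sum>i<k. \<bar>c i\<bar>)" using k2 by (intro member_le_sum) auto
  moreover have "\<bar>c 0\<bar> \<ge> 1" using c(3)[of 0] k2 by auto
  ultimately have C1: "C \<ge> 1" by (simp add: C_def)
  define \<Lambda> where "\<Lambda> = ln (real E)"
  have \<Lambda>: "\<Lambda> > 0" using E by (simp add: \<Lambda>_def)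
  define K where "K = ln (2 * real C ^ 2)"
  \<comment> \<open>Threshold for \<open>l = ln (1 / \<alpha>)\<close>: above it \<open>J\<close> is
    at least \<open>l / (4 * \<Lambda>) \<ge> 1\<close>, and the constant \<open>K\<close> is less
    than \<open>l / 2\<close>; below it the bound by the density is used.\<close>
  define l0 where "l0 = max (4 * \<Lambda>) (2 * K + 1)"
  have l0: "l0 > 0" "4 * \<Lambda> \<le> l0" "2 * K + 1 \<le> l0" using \<Lambda> by (auto simp: l0_def)
  define \<kappa> :: real where "\<kappa> = ln 4 / (16 * \<Lambda>\<^sup>2)"
  have \<kappa>: "\<kappa> > 0" using \<Lambda> by (simp add: \<kappa>_def)
  \<comment> \<open>The first term gives \<open>\<gamma> * l < 1\<close> for
    \<open>l \<le> l0\<close>, hence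
    \<open>\<alpha> = exp (- l) < exp (- (\<gamma> * l\<^sup>2))\<close>. The second keeps
    \<open>\<gamma>\<close> strictly below the exponent \<open>\<kappa>\<close> reached for larger
    \<open>l\<close>.\<close>
  define \<gamma> where "\<gamma> = min (1 / (2 * l0)) (\<kappa> / 2)"
  have \<gamma>: "\<gamma> > 0" "\<gamma> \<le> 1 / (2 * l0)" "\<gamma> < \<kappa>" using l0 \<kappa> by (auto simp: \<gamma>_def)
  show ?thesis
  proof (intro exI[of _ \<gamma>] conjI allI impI)
    show "\<gamma> > 0" by fact
    fix \<alpha> :: real assume \<alpha>: "0 < \<alpha> \<and> \<alpha> < 1/2"
    define l where "l = ln (1 / \<alpha>)"
    have l: "l > 0" using \<alpha> by (simp add: l_def)
    have \<alpha>l: "\<alpha> = exp (- l)" using \<alpha> by (simp add: l_def ln_div)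
    have target: "\<alpha> powr (\<gamma> * ln (1 / \<alpha>)) = exp (- (\<gamma> * l\<^sup>2))"
      using \<alpha> by (simp add: powr_def l_def ln_div power2_eq_square)
    show "rho a \<alpha> < \<alpha> powr (\<gamma> * ln (1 / \<alpha>))"
    proof (cases "l \<le> l0")
      case True
      have "\<gamma> * l \<le> 1 / (2 * l0) * l0" using \<gamma> True l l0 by (intro mult_mono) auto
      also have "\<dots> < 1" using l0 by simp
      finally have "\<gamma> * l * l < 1 * l" using l by (intro mult_strict_right_mono)
      then have "\<alpha> < exp (- (\<gamma> * l\<^sup>2))" by (simp add: \<alpha>l power2_eq_square)
      moreover have "rho a \<alpha> \<le> \<alpha>" by (rule rho_le, rule rho_bound_le_density[OF _ s]) (use \<alpha> in auto)
      ultimately show ?thesis by (simp add: target)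
    next
      case False
      \<comment> \<open>The largest \<open>J\<close> with \<open>E ^ J \<le> exp (l / 2)\<close>:
        then \<open>E ^ J * \<alpha>\<close> is at most \<open>exp (- l / 2)\<close>, which leaves
        room for the factor \<open>2 * C ^ 2\<close>. Since \<open>J\<close> is of order
        \<open>l\<close>, \<open>4 ^ (J * J)\<close> is exponential in
        \<open>l\<^sup>2\<close>.\<close>
      define J where "J = nat \<lfloor>l / (2 * \<Lambda>)\<rfloor>"
      have J: "real J \<le> l / (2 * \<Lambda>)" "l / (2 * \<Lambda>) < real J + 1"
        using l \<Lambda> by (simp_all add: J_def)
      have q: "l / (4 * \<Lambda>) \<ge> 1" using False l0 \<Lambda> by simp
      have half: "l / (2 * \<Lambda>) = 2 * (l / (4 * \<Lambda>))" by simp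
      have J4: "real J \<ge> l / (4 * \<Lambda>)" using J q half by linarith
      then have J1: "J \<ge> 1" using q by linarith
      obtain m f where mf: "4 ^ (J * J) \<le> m" "\<And>n. 0 \<le> f n \<and> f n \<le> int E ^ J"
          "\<And>x y. int m dvd x - y \<Longrightarrow> f x = f y"
          "\<And>n d. (\<Sum>i<k. c i * f (n + a ! i * d)) = 0 \<Longrightarrow> int m dvd d"
        using detect[OF J1] by blast
      have m: "m > 0" using mf(1) by (rule less_le_trans[rotated]) simp
      have "2 * real C ^ 2 * real (E ^ J) * \<alpha> = exp (K + real J * \<Lambda> - l)"
        using C1 E by (simp add: K_def \<Lambda>_def exp_add exp_diff \<alpha>l exp_minus exp_of_nat_mult divide_inverse)
      also have "\<dots> < 1"
      proof -
        have "real J * \<Lambda> \<le> l / 2" using J(1) \<Lambda> by (simp add: field_simps)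
        then have "K + real J * \<Lambda> - l < 0" using False l0(3) by linarith
        then show ?thesis by simp
      qed
      finally have small: "2 * real C ^ 2 * real (E ^ J) * \<alpha> < 1" .
      have "r \<le> 1 / real m" if "rho_bound a \<alpha> r" for r
      proof (rule rho_bound_le_inverse[OF that s _ _ _ C C1 m _ _ _ _ small])
        show "(\<Sum>i<length a. c i * a ! i ^ e) = 0" if "e \<le> Suc s" for e
          using c(1)[of e] that s assms(2) by simp
        show "0 < \<alpha>" "\<alpha> < 1" "1 \<le> E ^ J" using \<alpha> E by auto
        show "f x = f y" if "int m dvd x - y" for x y using that by (rule mf(3))
        show "0 \<le> f n \<and> f n \<le> int (E ^ J)" for n using mf(2)[of n] by simp
        show "int m dvd d" if "(\<Sum>i<length a. c i * f (n + a ! i * d)) = 0" for n d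
          using mf(4)[of n d] that assms(2) by simp
      qed
      then have "rho a \<alpha> \<le> 1 / real m" by (rule rho_le)
      also have "\<dots> \<le> 1 / 4 ^ (J * J)"
      proof (rule frac_le)
        show "4 ^ (J * J) \<le> real m" using mf(1) by (metis of_nat_le_iff of_nat_numeral of_nat_power)
      qed auto
      also have "\<dots> = exp (- (ln 4 * (real J)\<^sup>2))"
      proof -
        have "(4::real) ^ (J * J) = exp (real (J * J) * ln 4)" by (subst exp_of_nat_mult) simp
        then show ?thesis by (simp add: exp_minus divide_inverse power2_eq_square mult_ac)
      qed
      also have "\<dots> \<le> exp (- (\<kappa> * l\<^sup>2))"
      proof -
        have "(l / (4 * \<Lambda>))\<^sup>2 \<le> (real J)\<^sup>2" using J4 q by (intro power_mono) auto
        then have "ln 4 * (l / (4 * \<Lambda>))\<^sup>2 \<le> ln 4 * (real J)\<^sup>2" by (intro mult_left_mono) auto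
        moreover have "\<kappa> * l\<^sup>2 = ln 4 * (l / (4 * \<Lambda>))\<^sup>2" by (simp add: \<kappa>_def power_divide power_mult_distrib)
        ultimately show ?thesis by simp
      qed
      also have "\<dots> < exp (- (\<gamma> * l\<^sup>2))" using \<gamma>(3) l by simp
      finally show ?thesis by (simp add: target)
    qed
  qed
qed

end
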